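(* Let $G$ be a $\sigma$-compact locally compact abelian group with a countable dense subset. Let $(X,\alpha,m)$ and $(X',\alpha',m')$ be ergodic dynamical systems over $G$, and let $\mathcal A$ be a van Hove sequence in $G$ along which the Birkhoff ergodic theorem holds for both systems. Let $f\in C(X)$ and $g\in C(X')$ be given with mutually singular spectral measures, $\sigma_f\perp\sigma_g$. Then for $m\times m'$-almost every $(x,x')\in X\times X'$ the reflected Eberlein convolution of $f_x$ and $g_{x'}$ exists and $$\langle\!\langle f_x,g_{x'}\rangle\!\rangle_{\mathcal A}=0.$$
   Context: $G$ is written additively with fixed Haar measure, $|A|$ denoting the Haar measure of $A$. $\widehat G$ is the group of continuous homomorphisms $\xi:G\to\mathbb T$. For compact $K\subseteq G$, $\partial^KA:=(\overline{A+K}\setminus A)\cup(((G\setminus A)-K)\cap\overline A)$. A van Hove sequence is a sequence $\mathcal A=(A_n)$ of open subsets of $G$ with compact closure (with $|A_n|>0$) such that $\lim_n|\partial^KA_n|/|A_n|=0$ for every compact $K\subseteq G$. For bounded uniformly continuous $u,v:G\to\mathbb C$, $\langle\!\langle u,v\rangle\!\rangle_{\mathcal A}$ is said to exist if $\lim_n\frac1{|A_n|}\int_{A_n}u(s)\overline{v(s-t)}\,ds$ exists for every $t\in G$, and $\langle\!\langle u,v\rangle\!\rangle_{\mathcal A}(t)$ is then this limit. A dynamical system over $G$ is a triple $(X,\alpha,m)$ with $X$ a compact (Hausdorff) space, $\alpha$ a continuous action of $G$ on $X$ and $m$ an $\alpha$-invariant probability measure on $X$. It is ergodic if every $\alpha$-invariant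 measurable set has measure $0$ or $1$. The Birkhoff theorem holds along $\mathcal A$ if for every integrable $h$ on $X$, $\lim_n\frac1{|A_n|}\int_{A_n}h(\alpha_tx)\,dt=\int_Xh\,dm$ for $m$-almost every $x\in X$. The associated unitary representation of $G$ on $L^2(X,m)$ is $T_tf=f\circ\alpha_t$; the spectral measure $\sigma_f$ of $f\in L^2(X,m)$ is the unique finite positive measure on $\widehat G$ with $\langle f,T_tf\rangle=\int_{\widehat G}\xi(t)\,d\sigma_f(\xi)$ for all $t\in G$ (inner product linear in the first argument). For $f:X\to\mathbb C$ and $x\in X$, $f_x:G\to\mathbb C$ is $f_x(t)=f(\alpha_tx)$. Positive measures $\rho,\sigma$ on $\widehat G$ are mutually singular if there are disjoint measurable sets $A,B$ with $\rho(\widehat G\setminus A)=0=\sigma(\widehat G\setminus B)$. *)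

theory Defs
  imports "HOL-Probability.Probability"
begin

definition sigma_compact :: "'a::topological_space set \<Rightarrow> bool" where
  "sigma_compact S \<longleftrightarrow> (\<exists>K :: nat \<Rightarrow> 'a set. (\<forall>n. compact (K n)) \<and> (\<Union>n. K n) = S)"

definition haar_measure :: "'g::topological_ab_group_add measure \<Rightarrow> bool" where
  "haar_measure \<mu> \<longleftrightarrow>
     sets \<mu> = sets borel \<and>
     emeasure \<mu> UNIV \<noteq> 0 \<and>
     (\<forall>K. compact K \<longrightarrow> emeasure \<mu> K < \<infinity>) \<and>
     (\<forall>B\<in>sets borel. emeasure \<mu> B = (INF U\<in>{U. open U \<and> B \<subseteq> U}. emeasure \<mu> U)) \<and>
     (\<forall>U. open U \<longrightarrow> emeasure \<mu> U = (SUP K\<in>{K. compact K \<and> K \<subseteq> U}. emeasure \<mu> K)) \<and>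
     (\<forall>t. \<forall>B\<in>sets borel. emeasure \<mu> ((\<lambda>s. t + s) ` B) = emeasure \<mu> B)"

definition van_hove_boundary :: "'g::topological_ab_group_add set \<Rightarrow> 'g set \<Rightarrow> 'g set" where
  "van_hove_boundary K A =
     (closure {a + k | a k. a \<in> A \<and> k \<in> K} - A) \<union>
     ({b - k | b k. b \<in> - A \<and> k \<in> K} \<inter> closure A)"

definition van_hove_sequence ::
    "'g::topological_ab_group_add measure \<Rightarrow> (nat \<Rightarrow> 'g set) \<Rightarrow> bool" where
  "van_hove_sequence \<mu> A \<longleftrightarrow>
     (\<forall>n. open (A n) \<and> compact (closure (A n)) \<and> measure \<mu> (A n) > 0) \<and>
     (\<forall>K. compact K \<longrightarrow>
        (\<lambda>n. measure \<mu> (van_hove_boundary K (A n)) / measure \<mu> (A n)) \<longlonglongrightarrow> 0)"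

definition set_mean :: "'g measure \<Rightarrow> 'g set \<Rightarrow> ('g \<Rightarrow> complex) \<Rightarrow> complex" where
  "set_mean \<mu> S h = (LINT s:S|\<mu>. h s) /\<^sub>R measure \<mu> S"

text \<open>
  Both notions below are meant for bounded uniformly continuous \<open>u\<close> and \<open>v\<close>,
  for which the integrals exist; the value is meaningful only if the convolution exists.
\<close>

definition reflected_eberlein_exists ::
    "'g::group_add measure \<Rightarrow> (nat \<Rightarrow> 'g set) \<Rightarrow> ('g \<Rightarrow> complex) \<Rightarrow> ('g \<Rightarrow> complex) \<Rightarrow> bool" where
  "reflected_eberlein_exists \<mu> A u v \<longleftrightarrow>
     (\<forall>t. convergent (\<lambda>n. set_mean \<mu> (A n) (\<lambda>s. u s * cnj (v (s - t)))))"

definition reflected_eberlein ::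
    "'g::group_add measure \<Rightarrow> (nat \<Rightarrow> 'g set) \<Rightarrow> ('g \<Rightarrow> complex) \<Rightarrow> ('g \<Rightarrow> complex) \<Rightarrow> 'g \<Rightarrow> complex" where
  "reflected_eberlein \<mu> A u v t = lim (\<lambda>n. set_mean \<mu> (A n) (\<lambda>s. u s * cnj (v (s - t))))"

definition dual_group :: "('g::topological_ab_group_add \<Rightarrow> complex) set" where
  "dual_group = {\<xi>. continuous_on UNIV \<xi> \<and> (\<forall>t. cmod (\<xi> t) = 1) \<and> (\<forall>s t. \<xi> (s + t) = \<xi> s * \<xi> t)}"

text \<open>The compact-open topology, i.e. uniform convergence on compact sets.\<close>

definition dual_topology :: "('g::topological_ab_group_add \<Rightarrow> complex) topology" where
  "dual_topology =
     topology_generated_by {{\<xi> \<in> dual_group. \<xi> ` K \<subseteq> U} | K U. compact K \<and> open U}"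

definition dual_borel :: "('g::topological_ab_group_add \<Rightarrow> complex) measure" where
  "dual_borel = sigma dual_group {U. openin dual_topology U}"

text \<open>
  Measures on the dual group are Radon measures. As the dual group need not be second
  countable, inner regularity is not automatic; it is what makes spectral measures unique.
\<close>

definition finite_radon_dual :: "('g::topological_ab_group_add \<Rightarrow> complex) measure \<Rightarrow> bool" where
  "finite_radon_dual \<sigma> \<longleftrightarrow>
     finite_measure \<sigma> \<and> sets \<sigma> = sets dual_borel \<and>
     (\<forall>B\<in>sets \<sigma>. emeasure \<sigma> B = (SUP K\<in>{K. compactin dual_topology K \<and> K \<subseteq> B}. emeasure \<sigma> K))"

definition mutually_singular :: "'a measure \<Rightarrow> 'a measure \<Rightarrow> bool" where
  "mutually_singular \<rho> \<sigma> \<longleftrightarrow>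
     sets \<rho> = sets \<sigma> \<and>
     (\<exists>A\<in>sets \<rho>. \<exists>B\<in>sets \<rho>. A \<inter> B = {} \<and>
        emeasure \<rho> (space \<rho> - A) = 0 \<and> emeasure \<sigma> (space \<sigma> - B) = 0)"

definition dynamical_system ::
    "('g::topological_ab_group_add \<Rightarrow> 'x::t2_space \<Rightarrow> 'x) \<Rightarrow> 'x measure \<Rightarrow> bool" where
  "dynamical_system \<alpha> m \<longleftrightarrow>
     compact (UNIV :: 'x set) \<and>
     continuous_on UNIV (\<lambda>(t, x). \<alpha> t x) \<and>
     (\<forall>x. \<alpha> 0 x = x) \<and> (\<forall>s t x. \<alpha> (s + t) x = \<alpha> s (\<alpha> t x)) \<and>
     sets m = sets borel \<and> prob_space m \<and>
     (\<forall>t. \<forall>B\<in>sets m. emeasure m (\<alpha> t -` B) = emeasure m B)"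

definition ergodic_system ::
    "('g::topological_ab_group_add \<Rightarrow> 'x::t2_space \<Rightarrow> 'x) \<Rightarrow> 'x measure \<Rightarrow> bool" where
  "ergodic_system \<alpha> m \<longleftrightarrow>
     dynamical_system \<alpha> m \<and>
     (\<forall>B\<in>sets m. (\<forall>t. \<alpha> t -` B = B) \<longrightarrow> measure m B = 0 \<or> measure m B = 1)"

definition birkhoff_holds ::
    "'g measure \<Rightarrow> (nat \<Rightarrow> 'g set) \<Rightarrow> ('g \<Rightarrow> 'x \<Rightarrow> 'x) \<Rightarrow> 'x measure \<Rightarrow> bool" where
  "birkhoff_holds \<mu> A \<alpha> m \<longleftrightarrow>
     (\<forall>h :: 'x \<Rightarrow> complex. integrable m h \<longrightarrow>
        (AE x in m. (\<forall>n. set_integrable \<mu> (A n) (\<lambda>t. h (\<alpha> t x))) \<and>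
           (\<lambda>n. set_mean \<mu> (A n) (\<lambda>t. h (\<alpha> t x))) \<longlonglongrightarrow> (LINT x|m. h x)))"

definition koopman :: "('g \<Rightarrow> 'x \<Rightarrow> 'x) \<Rightarrow> 'g \<Rightarrow> ('x \<Rightarrow> complex) \<Rightarrow> 'x \<Rightarrow> complex" where
  "koopman \<alpha> t f = f \<circ> \<alpha> t"

definition L2_inner :: "'x measure \<Rightarrow> ('x \<Rightarrow> complex) \<Rightarrow> ('x \<Rightarrow> complex) \<Rightarrow> complex" where
  "L2_inner m f g = (LINT x|m. f x * cnj (g x))"

definition is_spectral_measure ::
    "('g::topological_ab_group_add \<Rightarrow> 'x \<Rightarrow> 'x) \<Rightarrow> 'x measure \<Rightarrow> ('x \<Rightarrow> complex) \<Rightarrow>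
     ('g \<Rightarrow> complex) measure \<Rightarrow> bool" where
  "is_spectral_measure \<alpha> m f \<sigma> \<longleftrightarrow>
     finite_radon_dual \<sigma> \<and>
     (\<forall>t. L2_inner m f (koopman \<alpha> t f) = (LINT \<xi>|\<sigma>. \<xi> t))"

definition orbit_fun :: "('g \<Rightarrow> 'x \<Rightarrow> 'x) \<Rightarrow> ('x \<Rightarrow> complex) \<Rightarrow> 'x \<Rightarrow> 'g \<Rightarrow> complex" where
  "orbit_fun \<alpha> f x t = f (\<alpha> t x)"

end

theory Submission
  imports Defs
begin

text \<open>
  The reflected Eberlein convolution is a mean of \<open>f(\<alpha>\<^sub>s x)\<close> against the conjugate of
  \<open>g(\<alpha>'\<^sub>s\<^sub>-\<^sub>t x')\<close>, and it vanishes because one trigonometric polynomial filter can kill \<open>f\<close> and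
  preserve \<open>g\<close>. Since \<open>\<sigma>\<^sub>f\<close> and \<open>\<sigma>\<^sub>g\<close> are mutually singular Radon measures, for each \<open>\<epsilon> > 0\<close> there is a
  trigonometric polynomial \<open>p(\<xi>) = \<Sum>\<^sub>r c\<^sub>r \<xi>(r)\<close> with values in \<open>[0, 1]\<close> on the dual group that is close to 0
  in \<open>L\<^sup>2(\<sigma>\<^sub>f)\<close> and close to 1 in \<open>L\<^sup>2(\<sigma>\<^sub>g)\<close> (\<open>mutually_singular_trig_poly\<close>). Such a \<open>p\<close> comes from the
  Stone-Weierstrass theorem on the Bohr compactification of the dual group: it separates a compact
  set that carries almost all of \<open>\<sigma>\<^sub>f\<close> from one that carries almost all of \<open>\<sigma>\<^sub>g\<close>, and being bounded on the
  whole compactification it is also harmless off these two sets.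

  The map that sends a combination of translates of \<open>f\<close> to the corresponding trigonometric polynomial
  is an isometry into \<open>L\<^sup>2(\<sigma>\<^sub>f)\<close> (\<open>spectral_isometry\<close>), so the functions \<open>F = \<Sum>\<^sub>r c\<^sub>r f \<circ> \<alpha>\<^sub>-\<^sub>r\<close> and
  \<open>H = g - \<Sum>\<^sub>r cnj c\<^sub>r g \<circ> \<alpha>'\<^sub>r\<close> are small in \<open>L\<^sup>2\<close>, hence in \<open>L\<^sup>1\<close>. By Birkhoff's theorem for \<open>\<bar>F\<bar>\<close> and
  \<open>\<bar>H\<bar>\<close> their means along almost every orbit are eventually small. Taking \<open>\<epsilon> = 1, 1/2, 1/3, \<dots>\<close> leaves
  one null set of exceptional points in each of the two spaces, and neither of them depends on \<open>t\<close>.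

  What remains is a statement about two bounded continuous functions \<open>u\<close>, \<open>v\<close> on \<open>G\<close>
  (\<open>reflected_mean_tendsto_zero\<close>). In the mean of \<open>u(s)\<close> against \<open>v(s - t)\<close> replace \<open>v\<close> by its filtered
  version, at a small cost, and then move the filter to \<open>u\<close>, which it makes small. Moving a
  translation from one factor to the other changes the mean by a quantity that tends to 0, because
  the sets \<open>A\<^sub>n\<close> form a van Hove sequence (\<open>set_mean_shift_tendsto\<close>). This bounds the upper limit by a
  constant multiple of \<open>\<epsilon>\<close> for every \<open>t\<close>, which gives existence and vanishing of the limit at once.
\<close>

section \<open>Stone-Weierstrass on the Bohr compactification of the dual group\<close>

text \<open>
  A copy of the space of all families of complex numbers, with pointwise convergence, that belongs
  to the class \<open>t2_space\<close> for every index type. The function type itself is in that class for countable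
  index types only, and Stone-Weierstrass is applied on a space of the class.
\<close>

typedef 'i complex_family = "UNIV :: ('i \<Rightarrow> complex) set"
  morphisms coords family by simp

lemmas complex_family_simps [simp] = family_inverse[OF UNIV_I] coords_inverse

instantiation complex_family :: (type) topological_space
begin

definition open_complex_family :: "'a complex_family set \<Rightarrow> bool" where
  "open_complex_family U \<longleftrightarrow> open (family -` U)"

instance
  by standard (auto simp: open_complex_family_def vimage_Union)

end

lemma continuous_on_family: "continuous_on X family"
  by (rule continuous_on_subset[of UNIV]) (auto simp: continuous_on_open_vimage open_complex_family_def)

lemma continuous_on_coords: "continuous_on X coords"
  by (rule continuous_on_subset[of UNIV])
     (auto simp: continuous_on_open_vimage open_complex_family_def vimage_def)

lemma Hausdorff_space_pointwise: "Hausdorff_space (euclidean :: ('i \<Rightarrow> complex) topology)"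
  by (simp add: euclidean_product_topology[symmetric] Hausdorff_space_product_topology)

instance complex_family :: (type) t2_space
proof
  fix x y :: "'a complex_family"
  assume "x \<noteq> y"
  then have "coords x \<noteq> coords y"
    by (simp add: coords_inject)
  then obtain U V where UV: "open U" "open V" "coords x \<in> U" "coords y \<in> V" "U \<inter> V = {}"
    using Hausdorff_space_pointwise[where 'i='a]
    unfolding Hausdorff_space_def disjnt_def open_openin[symmetric] topspace_euclidean
    by (metis UNIV_I)
  then have "open (coords -` U)" "open (coords -` V)"
    using continuous_on_coords[of UNIV] by (auto intro: open_vimage)
  then show "\<exists>U V. open U \<and> open V \<and> x \<in> U \<and> y \<in> V \<and> U \<inter> V = {}"
    using UV by (intro exI[of _ "coords -` U"] exI[of _ "coords -` V"]) auto
qed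

lemma compact_pointwise_imp_closed: "compact K \<Longrightarrow> closed K" for K :: "('i \<Rightarrow> complex) set"
  using compactin_imp_closedin[OF Hausdorff_space_pointwise, of K] by simp

text \<open>
  All homomorphisms into the circle, continuous or not: the Bohr compactification of the dual group.
  For the pointwise topology this set is compact, which the dual group itself need not be.
\<close>

definition bohr_dual :: "('g::ab_group_add \<Rightarrow> complex) set" where
  "bohr_dual = {\<xi>. (\<forall>t. cmod (\<xi> t) = 1) \<and> (\<forall>s t. \<xi> (s + t) = \<xi> s * \<xi> t)}"

lemma bohr_dualD:
  assumes "\<xi> \<in> bohr_dual"
  shows "cmod (\<xi> t) = 1" and "\<xi> (s + t) = \<xi> s * \<xi> t" and "\<xi> 0 = 1" and "\<xi> (- t) = cnj (\<xi> t)"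
proof -
  show norm: "cmod (\<xi> t) = 1" and add: "\<xi> (s + t) = \<xi> s * \<xi> t" for s t
    using assms by (auto simp: bohr_dual_def)
  have "\<xi> 0 \<noteq> 0"
    using norm[of 0] by auto
  then show zero: "\<xi> 0 = 1"
    using add[of 0 0] by simp
  have "\<xi> t * \<xi> (- t) = 1"
    using add[of t "- t"] zero by simp
  moreover have "\<xi> t * cnj (\<xi> t) = 1"
    using norm[of t] by (simp add: complex_norm_square[symmetric])
  ultimately show "\<xi> (- t) = cnj (\<xi> t)"
    by (metis mult_cancel_left mult_zero_left zero_neq_one)
qed

lemma dual_group_subset_bohr_dual: "dual_group \<subseteq> bohr_dual"
  by (auto simp: dual_group_def bohr_dual_def)

text \<open>
  Tychonoff's theorem, since the homomorphism equations are closed conditions.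
\<close>

lemma compact_bohr_dual: "compact (bohr_dual :: ('g::ab_group_add \<Rightarrow> complex) set)"
proof -
  define T :: "('g \<Rightarrow> complex) set" where "T = (\<Pi>\<^sub>E t\<in>UNIV. sphere 0 1)"
  have "compactin (product_topology (\<lambda>t. euclidean) UNIV) T"
    unfolding T_def by (simp add: compactin_PiE)
  then have "compact T"
    by (simp add: euclidean_product_topology)
  moreover have "closed {\<xi> :: 'g \<Rightarrow> complex. \<forall>s t. \<xi> (s + t) = \<xi> s * \<xi> t}"
    by (intro closed_Collect_all closed_Collect_eq continuous_intros
        continuous_on_product_coordinates)
  ultimately have "compact (T \<inter> {\<xi>. \<forall>s t. \<xi> (s + t) = \<xi> s * \<xi> t})"
    by (rule compact_Int_closed)
  also have "T \<inter> {\<xi>. \<forall>s t. \<xi> (s + t) = \<xi> s * \<xi> t} = bohr_dual"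
    by (auto simp: bohr_dual_def T_def)
  finally show ?thesis .
qed

definition trig_poly :: "'g set \<Rightarrow> ('g \<Rightarrow> complex) \<Rightarrow> ('g \<Rightarrow> complex) \<Rightarrow> complex" where
  "trig_poly S c \<xi> = (\<Sum>t\<in>S. c t * \<xi> t)"

text \<open>
  The algebra to which the real Stone-Weierstrass theorem is applied: trigonometric polynomials with
  complex coefficients but real values.
\<close>

definition trig_poly_on_bohr :: "(('g::ab_group_add \<Rightarrow> complex) \<Rightarrow> real) set" where
  "trig_poly_on_bohr = {h. continuous_on bohr_dual h \<and>
     (\<exists>S c. finite S \<and> (\<forall>\<xi>\<in>bohr_dual. complex_of_real (h \<xi>) = trig_poly S c \<xi>))}"

text \<open>
  The frequency 0 can be added to the spectrum, so that \<open>1 - h\<close> is a polynomial with the same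
  frequencies as \<open>h\<close>.
\<close>

lemma trig_poly_on_bohrE:
  assumes "h \<in> trig_poly_on_bohr"
  obtains S c where "finite S" "0 \<in> S"
    "\<And>\<xi>. \<xi> \<in> bohr_dual \<Longrightarrow> complex_of_real (h \<xi>) = trig_poly S c \<xi>"
proof -
  from assms obtain S c where S: "finite S"
    and h: "\<And>\<xi>. \<xi> \<in> bohr_dual \<Longrightarrow> complex_of_real (h \<xi>) = trig_poly S c \<xi>"
    unfolding trig_poly_on_bohr_def by blast
  have eq: "trig_poly S c \<xi> = trig_poly (insert 0 S) (\<lambda>t. if t \<in> S then c t else 0) \<xi>" for \<xi>
    unfolding trig_poly_def using S by (intro sum.mono_neutral_cong_left) auto
  show thesis
    by (rule that[of "insert 0 S" "\<lambda>t. if t \<in> S then c t else 0"])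
       (use S in \<open>simp_all add: h eq[symmetric]\<close>)
qed

text \<open>
  Repeated frequencies may occur in the index family; their coefficients are added up.
\<close>

lemma trig_poly_on_bohrI:
  assumes "continuous_on bohr_dual h" "finite I"
    and h: "\<And>\<xi>. \<xi> \<in> bohr_dual \<Longrightarrow> complex_of_real (h \<xi>) = (\<Sum>i\<in>I. a i * \<xi> (\<tau> i))"
  shows "h \<in> trig_poly_on_bohr"
proof -
  have "(\<Sum>i\<in>I. a i * \<xi> (\<tau> i)) = trig_poly (\<tau> ` I) (\<lambda>t. \<Sum>i\<in>{i\<in>I. \<tau> i = t}. a i) \<xi>" for \<xi>
    unfolding trig_poly_def using assms(2) by (subst sum.image_gen[of I _ \<tau>]) (auto simp: sum_distrib_right intro!: sum.cong)
  then have "complex_of_real (h \<xi>) = trig_poly (\<tau> ` I) (\<lambda>t. \<Sum>i\<in>{i\<in>I. \<tau> i = t}. a i) \<xi>"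
    if "\<xi> \<in> bohr_dual" for \<xi>
    using h[OF that] by (rule trans[rotated])
  then show ?thesis
    using assms(1,2) unfolding trig_poly_on_bohr_def
    by (intro CollectI conjI exI[of _ "\<tau> ` I"] exI[of _ "\<lambda>t. \<Sum>i\<in>{i\<in>I. \<tau> i = t}. a i"]
        ballI finite_imageI)
qed

lemma trig_poly_on_bohr_algebra:
  fixes h k :: "('g::ab_group_add \<Rightarrow> complex) \<Rightarrow> real"
  assumes hk: "h \<in> trig_poly_on_bohr" "k \<in> trig_poly_on_bohr"
  shows "(\<lambda>x. h x + k x) \<in> trig_poly_on_bohr" and "(\<lambda>x. h x * k x) \<in> trig_poly_on_bohr"
proof -
  obtain S c where S: "finite S"
    and h: "\<And>\<xi>. \<xi> \<in> bohr_dual \<Longrightarrow> complex_of_real (h \<xi>) = trig_poly S c \<xi>"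
    using trig_poly_on_bohrE[OF hk(1)] by metis
  obtain T d where T: "finite T"
    and k: "\<And>\<xi>. \<xi> \<in> bohr_dual \<Longrightarrow> complex_of_real (k \<xi>) = trig_poly T d \<xi>"
    using trig_poly_on_bohrE[OF hk(2)] by metis
  have cont: "continuous_on bohr_dual h" "continuous_on bohr_dual k"
    using hk by (auto simp: trig_poly_on_bohr_def)
  show "(\<lambda>x. h x + k x) \<in> trig_poly_on_bohr"
  proof (rule trig_poly_on_bohrI[where I = "S <+> T" and a = "case_sum c d" and \<tau> = "case_sum id id"])
    fix \<xi> :: "'g \<Rightarrow> complex" assume \<xi>: "\<xi> \<in> bohr_dual"
    show "complex_of_real (h \<xi> + k \<xi>) = (\<Sum>i\<in>S <+> T. case_sum c d i * \<xi> (case_sum id id i))"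
      by (simp add: h[OF \<xi>] k[OF \<xi>] trig_poly_def sum.Plus[OF S T])
  qed (auto intro!: continuous_intros cont S T)
  show "(\<lambda>x. h x * k x) \<in> trig_poly_on_bohr"
  proof (rule trig_poly_on_bohrI[where I = "S \<times> T" and a = "\<lambda>(s, t). c s * d t" and \<tau> = "\<lambda>(s, t). s + t"])
    fix \<xi> :: "'g \<Rightarrow> complex" assume \<xi>: "\<xi> \<in> bohr_dual"
    show "complex_of_real (h \<xi> * k \<xi>) =
        (\<Sum>i\<in>S \<times> T. (case i of (s, t) \<Rightarrow> c s * d t) * \<xi> (case i of (s, t) \<Rightarrow> s + t))"
      by (simp add: h[OF \<xi>] k[OF \<xi>] trig_poly_def sum_product sum.cartesian_product bohr_dualD(2)[OF \<xi>]
          split_def mult_ac)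
  qed (auto intro!: continuous_intros cont S T)
qed

lemma trig_poly_on_bohr_const:
  "(\<lambda>_. k) \<in> (trig_poly_on_bohr :: (('g::ab_group_add \<Rightarrow> complex) \<Rightarrow> real) set)"
proof (rule trig_poly_on_bohrI[where I = "{()}" and a = "\<lambda>_. of_real k" and \<tau> = "\<lambda>_. 0"])
  fix \<xi> :: "'g \<Rightarrow> complex" assume \<xi>: "\<xi> \<in> bohr_dual"
  show "complex_of_real k = (\<Sum>i\<in>{()}. of_real k * \<xi> 0)"
    by (simp add: bohr_dualD(3)[OF \<xi>])
qed auto

lemma trig_poly_on_bohr_separates:
  fixes \<xi> \<eta> :: "'g::ab_group_add \<Rightarrow> complex"
  assumes "\<xi> \<noteq> \<eta>"
  shows "\<exists>h\<in>trig_poly_on_bohr. h \<xi> \<noteq> h \<eta>"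
proof -
  from assms obtain t where t: "\<xi> t \<noteq> \<eta> t" by auto
  have coord: "continuous_on bohr_dual (\<lambda>\<zeta> :: 'g \<Rightarrow> complex. \<zeta> t)"
    by (rule continuous_on_subset[OF continuous_on_product_coordinates]) simp
  have "(\<lambda>\<zeta> :: 'g \<Rightarrow> complex. Re (\<zeta> t)) \<in> trig_poly_on_bohr"
  proof (rule trig_poly_on_bohrI[where I = "{True, False}" and a = "\<lambda>_. 1 / 2" and
        \<tau> = "\<lambda>b. if b then t else - t"])
    fix \<zeta> :: "'g \<Rightarrow> complex" assume \<zeta>: "\<zeta> \<in> bohr_dual"
    show "complex_of_real (Re (\<zeta> t)) = (\<Sum>b\<in>{True, False}. 1 / 2 * \<zeta> (if b then t else - t))"
      by (simp add: bohr_dualD(4)[OF \<zeta>] complex_eq_iff)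
  qed (auto intro!: continuous_intros coord)
  moreover have "(\<lambda>\<zeta> :: 'g \<Rightarrow> complex. Im (\<zeta> t)) \<in> trig_poly_on_bohr"
  proof (rule trig_poly_on_bohrI[where I = "{True, False}" and
        a = "\<lambda>b. if b then - \<i> / 2 else \<i> / 2" and \<tau> = "\<lambda>b. if b then t else - t"])
    fix \<zeta> :: "'g \<Rightarrow> complex" assume \<zeta>: "\<zeta> \<in> bohr_dual"
    show "complex_of_real (Im (\<zeta> t)) =
        (\<Sum>b\<in>{True, False}. (if b then - \<i> / 2 else \<i> / 2) * \<zeta> (if b then t else - t))"
      by (simp add: bohr_dualD(4)[OF \<zeta>] complex_eq_iff)
  qed (auto intro!: continuous_intros coord)
  ultimately show ?thesis
    using t by (metis complex_eqI)
qed

text \<open>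
  The bounds \<open>0 \<le> h \<le> 1\<close> hold on all of \<open>bohr_dual\<close>, not only on \<open>K\<close> and \<open>L\<close>, because
  Stone-Weierstrass is applied on the whole compactification.
\<close>

lemma trig_poly_separates_compacts:
  fixes K L :: "('g::ab_group_add \<Rightarrow> complex) set"
  assumes K: "compact K" "K \<subseteq> bohr_dual" and L: "compact L" "L \<subseteq> bohr_dual"
    and disj: "K \<inter> L = {}" and e: "0 < e" "e < 1"
  obtains S c h where "finite S" "0 \<in> S"
    "\<And>\<xi>. \<xi> \<in> bohr_dual \<Longrightarrow> complex_of_real (h \<xi>) = trig_poly S c \<xi>"
    "\<And>\<xi>. \<xi> \<in> bohr_dual \<Longrightarrow> h \<xi> \<in> {0..1}"
    "\<And>\<xi>. \<xi> \<in> K \<Longrightarrow> h \<xi> < e" "\<And>\<xi>. \<xi> \<in> L \<Longrightarrow> h \<xi> > 1 - e"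
proof -
  define P where "P = (trig_poly_on_bohr :: (('g \<Rightarrow> complex) \<Rightarrow> real) set)"
  interpret function_ring_on "(\<lambda>h. h \<circ> coords) ` P" "family ` (bohr_dual :: ('g \<Rightarrow> complex) set)"
  proof
    show "compact (family ` (bohr_dual :: ('g \<Rightarrow> complex) set))"
      by (intro compact_continuous_image continuous_on_family compact_bohr_dual)
    show "continuous_on (family ` bohr_dual) h" if "h \<in> (\<lambda>h. h \<circ> coords) ` P" for h
      using that by (auto simp: P_def trig_poly_on_bohr_def image_image
          intro!: continuous_on_compose continuous_on_coords)
    show "(\<lambda>x. h x + k x) \<in> (\<lambda>h. h \<circ> coords) ` P" "(\<lambda>x. h x * k x) \<in> (\<lambda>h. h \<circ> coords) ` P"
      if hk: "h \<in> (\<lambda>h. h \<circ> coords) ` P" "k \<in> (\<lambda>h. h \<circ> coords) ` P" for h k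
    proof -
      from hk obtain h' k' where h: "h = h' \<circ> coords" "h' \<in> P" and k: "k = k' \<circ> coords" "k' \<in> P"
        by blast
      show "(\<lambda>x. h x + k x) \<in> (\<lambda>h. h \<circ> coords) ` P"
        by (rule image_eqI[of _ _ "\<lambda>x. h' x + k' x"])
           (use h k trig_poly_on_bohr_algebra(1) in \<open>simp_all add: P_def fun_eq_iff\<close>)
      show "(\<lambda>x. h x * k x) \<in> (\<lambda>h. h \<circ> coords) ` P"
        by (rule image_eqI[of _ _ "\<lambda>x. h' x * k' x"])
           (use h k trig_poly_on_bohr_algebra(2) in \<open>simp_all add: P_def fun_eq_iff\<close>)
    qed
    show "(\<lambda>_. k) \<in> (\<lambda>h. h \<circ> coords) ` P" for k
      by (rule image_eqI[of _ _ "\<lambda>_. k"]) (simp_all add: P_def trig_poly_on_bohr_const fun_eq_iff)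
    show "\<exists>h\<in>(\<lambda>h. h \<circ> coords) ` P. h x \<noteq> h y" if "x \<noteq> y" for x y
      using trig_poly_on_bohr_separates[of "coords x" "coords y"] that
      by (auto simp: P_def coords_inject)
  qed
  have "closed (family ` X)" if "compact X" for X :: "('g \<Rightarrow> complex) set"
    by (intro compact_imp_closed compact_continuous_image continuous_on_family that)
  then obtain h where h: "h \<in> P" "(h \<circ> coords) ` family ` bohr_dual \<subseteq> {0..1}"
    "\<forall>\<xi>\<in>K. h \<xi> < e" "\<forall>\<xi>\<in>L. h \<xi> > 1 - e"
  proof -
    have "inj family"
      by (simp add: inj_def family_inject)
    then have "family ` K \<inter> family ` L = {}"
      using disj by (metis image_Int image_empty)
    then have "\<exists>k\<in>(\<lambda>h. h \<circ> coords) ` P. k ` family ` bohr_dual \<subseteq> {0..1} \<and>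
        (\<forall>x\<in>family ` K. k x < e) \<and> (\<forall>x\<in>family ` L. k x > 1 - e)"
      by (intro two \<open>\<And>X. compact X \<Longrightarrow> closed (family ` X)\<close> image_mono K L e)
    then show thesis
      using that by (auto simp: image_image)
  qed
  from h(1) obtain S c where "finite S" "0 \<in> S"
    "\<And>\<xi>. \<xi> \<in> bohr_dual \<Longrightarrow> complex_of_real (h \<xi>) = trig_poly S c \<xi>"
    unfolding P_def using trig_poly_on_bohrE[of h] by metis
  with h show thesis
    by (intro that[of S h c]) (simp_all add: image_subset_iff)
qed

section \<open>Borel and Radon measures on the dual group\<close>

lemma topspace_dual_topology: "topspace dual_topology = dual_group"
proof -
  have "dual_group \<in> {{\<xi> \<in> dual_group. \<xi> ` K \<subseteq> U} | K U. compact K \<and> open U}"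
    by (rule CollectI, rule exI[of _ "{}"], rule exI[of _ UNIV]) auto
  then show ?thesis
    unfolding dual_topology_def topology_generated_by_topspace by blast
qed

lemma continuous_map_dual_topology_evaluation:
  "continuous_map dual_topology euclidean (\<lambda>\<xi>. \<xi> t)"
proof -
  have "openin dual_topology {\<xi> \<in> dual_group. \<xi> t \<in> U}" if "open U" for U :: "complex set"
    unfolding dual_topology_def
    by (rule topology_generated_by_Basis) (use that in \<open>auto intro!: exI[of _ "{t}"] exI[of _ U]\<close>)
  then show ?thesis
    by (auto simp: continuous_map_def topspace_dual_topology)
qed

text \<open>
  The compact-open topology is finer than the pointwise one, so its compact sets are compact
  in \<open>bohr_dual\<close> as well.
\<close>

lemma continuous_map_dual_topology_pointwise:
  "continuous_map dual_topology (euclidean :: ('g::topological_ab_group_add \<Rightarrow> complex) topology) id"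
  by (simp add: euclidean_product_topology[symmetric] continuous_map_componentwise_UNIV
      continuous_map_dual_topology_evaluation id_def)

lemma compactin_dual_topology_imp_compact:
  "compactin dual_topology K \<Longrightarrow> compact K"
  using image_compactin[OF _ continuous_map_dual_topology_pointwise, of K] by simp

lemma openin_dual_topology_imp_subset:
  "{U. openin dual_topology U} \<subseteq> Pow dual_group"
  using openin_subset topspace_dual_topology by fastforce

lemma space_dual_borel: "space dual_borel = dual_group"
  unfolding dual_borel_def by (simp add: space_measure_of openin_dual_topology_imp_subset)

lemma openin_dual_topology_in_dual_borel: "openin dual_topology U \<Longrightarrow> U \<in> sets dual_borel"
  unfolding dual_borel_def by (simp add: openin_dual_topology_imp_subset)

lemma measurable_evaluation_dual_borel: "(\<lambda>\<xi>. \<xi> t) \<in> borel_measurable dual_borel"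
proof (rule borel_measurableI)
  fix U :: "complex set" assume "open U"
  then show "(\<lambda>\<xi>. \<xi> t) -` U \<inter> space dual_borel \<in> sets dual_borel"
    using continuous_map_dual_topology_evaluation[of t]
    by (auto simp: continuous_map_def space_dual_borel topspace_dual_topology
        intro!: openin_dual_topology_in_dual_borel) (simp add: Int_def conj_commute)
qed

text \<open>
  A compact set is closed already for the coarser Hausdorff topology of pointwise convergence.
\<close>

lemma compactin_dual_topology_in_dual_borel:
  assumes "compactin dual_topology K"
  shows "K \<in> sets dual_borel"
proof -
  have "open (- K)"
    using compactin_dual_topology_imp_compact[OF assms] compact_pointwise_imp_closed by blast
  then have "openin dual_topology {\<xi> \<in> topspace dual_topology. id \<xi> \<in> - K}"
    using continuous_map_dual_topology_pointwise unfolding continuous_map_def by auto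
  also have "{\<xi> \<in> topspace dual_topology. id \<xi> \<in> - K} = space dual_borel - K"
    by (auto simp: topspace_dual_topology space_dual_borel)
  finally have "space dual_borel - (space dual_borel - K) \<in> sets dual_borel"
    using openin_dual_topology_in_dual_borel by blast
  moreover have "K \<subseteq> space dual_borel"
    using compactin_subset_topspace[OF assms] by (simp add: topspace_dual_topology space_dual_borel)
  ultimately show ?thesis
    by (simp add: double_diff)
qed

lemma finite_radon_dualD:
  assumes "finite_radon_dual \<sigma>"
  shows "finite_measure \<sigma>" "sets \<sigma> = sets dual_borel" "space \<sigma> = dual_group"
  using assms sets_eq_imp_space_eq[of \<sigma> dual_borel]
  by (simp_all add: finite_radon_dual_def space_dual_borel)

text \<open>
  Inner regularity, for a measure that is carried by \<open>B\<close>.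
\<close>

lemma finite_radon_dual_concentrated:
  assumes \<sigma>: "finite_radon_dual \<sigma>" and B: "B \<in> sets \<sigma>" "emeasure \<sigma> (space \<sigma> - B) = 0"
    and \<eta>: "0 < \<eta>"
  obtains K where "compactin dual_topology K" "K \<subseteq> B" "measure \<sigma> (space \<sigma> - K) < \<eta>"
proof -
  interpret finite_measure \<sigma>
    by (rule finite_radon_dualD[OF \<sigma>])
  have full: "measure \<sigma> B = measure \<sigma> (space \<sigma>)"
    using B finite_measure_compl[OF B(1)] by (simp add: measure_def)
  obtain K where K: "compactin dual_topology K" "K \<subseteq> B" "measure \<sigma> B - \<eta> < measure \<sigma> K"
  proof (cases "measure \<sigma> B = 0")
    case True
    then show thesis
      using \<eta> by (intro that[of "{}"]) auto
  next
    case False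
    then have "0 < measure \<sigma> B"
      by (simp add: zero_less_measure_iff)
    then have "ennreal (measure \<sigma> B - \<eta>) < emeasure \<sigma> B"
      using \<eta> by (simp add: emeasure_eq_measure ennreal_less_iff ennreal_lessI)
    also have "emeasure \<sigma> B = (SUP K\<in>{K. compactin dual_topology K \<and> K \<subseteq> B}. emeasure \<sigma> K)"
      using \<sigma> B(1) unfolding finite_radon_dual_def by blast
    finally obtain K where K: "compactin dual_topology K" "K \<subseteq> B"
      and less: "ennreal (measure \<sigma> B - \<eta>) < emeasure \<sigma> K"
      unfolding less_SUP_iff by blast
    have "measure \<sigma> B - \<eta> < measure \<sigma> K"
    proof (rule ccontr)
      assume "\<not> measure \<sigma> B - \<eta> < measure \<sigma> K"
      then have "ennreal (measure \<sigma> K) \<le> ennreal (measure \<sigma> B - \<eta>)"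
        by (intro ennreal_leI) simp
      then show False
        using less by (simp add: emeasure_eq_measure)
    qed
    with K show thesis
      by (rule that)
  qed
  have "K \<in> sets \<sigma>"
    using compactin_dual_topology_in_dual_borel[OF K(1)] finite_radon_dualD(2)[OF \<sigma>] by simp
  then have "measure \<sigma> (space \<sigma> - K) < \<eta>"
    using finite_measure_compl[of K] K(3) full by simp
  with K show thesis
    by (intro that)
qed

lemma trig_poly_measurable:
  assumes "finite_radon_dual \<sigma>"
  shows "trig_poly S c \<in> borel_measurable \<sigma>"
proof -
  have "(\<lambda>\<xi>. \<xi> t) \<in> borel_measurable \<sigma>" for t
    using measurable_evaluation_dual_borel[of t] finite_radon_dualD(2)[OF assms]
    by (simp cong: measurable_cong_sets)
  then have "(\<lambda>\<xi>. \<Sum>t\<in>S. c t * \<xi> t) \<in> borel_measurable \<sigma>"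
    by (intro borel_measurable_sum borel_measurable_times borel_measurable_const)
  then show ?thesis
    by (simp add: trig_poly_def[abs_def])
qed

lemma integral_le_small_off_compact:
  assumes \<sigma>: "finite_radon_dual \<sigma>" and K: "compactin dual_topology K"
    and meas: "p \<in> borel_measurable \<sigma>"
    and p: "\<And>\<xi>. \<xi> \<in> dual_group \<Longrightarrow> 0 \<le> p \<xi> \<and> p \<xi> \<le> 1" "\<And>\<xi>. \<xi> \<in> K \<Longrightarrow> p \<xi> \<le> d"
    and d: "0 \<le> d"
  shows "(LINT \<xi>|\<sigma>. p \<xi> :: real) \<le> d * measure \<sigma> (space \<sigma>) + measure \<sigma> (space \<sigma> - K)"
proof -
  interpret finite_measure \<sigma>
    by (rule finite_radon_dualD[OF \<sigma>])
  have K': "space \<sigma> - K \<in> sets \<sigma>"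
    using compactin_dual_topology_in_dual_borel[OF K] finite_radon_dualD(2)[OF \<sigma>] by blast
  have sp: "space \<sigma> = dual_group"
    by (rule finite_radon_dualD[OF \<sigma>])
  have int: "integrable \<sigma> p"
    using p(1) by (intro integrable_const_bound[where B = 1] meas) (auto simp: sp)
  have int': "integrable \<sigma> (indicator (space \<sigma> - K) :: _ \<Rightarrow> real)"
    using K' by (intro integrable_real_indicator) (simp_all add: emeasure_eq_measure)
  have "(LINT \<xi>|\<sigma>. p \<xi>) \<le> (LINT \<xi>|\<sigma>. d + indicator (space \<sigma> - K) \<xi>)"
  proof (rule integral_mono[OF int])
    show "integrable \<sigma> (\<lambda>\<xi>. d + indicator (space \<sigma> - K) \<xi>)"
      using int' by simp
    show "p \<xi> \<le> d + indicator (space \<sigma> - K) \<xi>" if "\<xi> \<in> space \<sigma>" for \<xi>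
      using p[of \<xi>] d that sp by (cases "\<xi> \<in> K") (auto simp: indicator_def)
  qed
  also have "\<dots> = d * measure \<sigma> (space \<sigma>) + measure \<sigma> (space \<sigma> - K)"
    using int' K' by (simp add: mult.commute)
  finally show ?thesis .
qed

text \<open>
  Choose disjoint compact sets \<open>K\<close>, \<open>L\<close> carrying \<open>\<rho>\<close> and \<open>\<sigma>\<close> up to \<open>e / 2\<close>, and a polynomial that is
  below \<open>d\<close> on \<open>K\<close> and above \<open>1 - d\<close> on \<open>L\<close>. As its values lie in \<open>[0, 1]\<close>, the integrands are at most \<open>d\<close> on
  \<open>K\<close> and \<open>L\<close>, and at most 1 elsewhere.
\<close>

lemma mutually_singular_trig_poly:
  fixes \<rho> \<sigma> :: "('g::topological_ab_group_add \<Rightarrow> complex) measure"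
  assumes \<rho>: "finite_radon_dual \<rho>" and \<sigma>: "finite_radon_dual \<sigma>"
    and sing: "mutually_singular \<rho> \<sigma>" and e: "0 < e"
  obtains S c where "finite S" "0 \<in> S"
    "(LINT \<xi>|\<rho>. (cmod (trig_poly S c \<xi>))\<^sup>2) < e"
    "(LINT \<xi>|\<sigma>. (cmod (1 - trig_poly S c \<xi>))\<^sup>2) < e"
proof -
  obtain A B where AB: "A \<in> sets \<rho>" "B \<in> sets \<sigma>" "A \<inter> B = {}"
    "emeasure \<rho> (space \<rho> - A) = 0" "emeasure \<sigma> (space \<sigma> - B) = 0"
    using sing unfolding mutually_singular_def by blast
  obtain K where K: "compactin dual_topology K" "K \<subseteq> A" "measure \<rho> (space \<rho> - K) < e / 2"
    using finite_radon_dual_concentrated[OF \<rho> AB(1,4), of "e / 2"] e by auto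
  obtain L where L: "compactin dual_topology L" "L \<subseteq> B" "measure \<sigma> (space \<sigma> - L) < e / 2"
    using finite_radon_dual_concentrated[OF \<sigma> AB(2,5), of "e / 2"] e by auto
  \<comment> \<open>The summand 1 only serves to make \<open>T\<close> positive.\<close>
  define T where "T = measure \<rho> (space \<rho>) + measure \<sigma> (space \<sigma>) + 1"
  define d where "d = min (1 / 2) (e / (2 * T))"
  have T: "0 < T" "measure \<rho> (space \<rho>) \<le> T" "measure \<sigma> (space \<sigma>) \<le> T"
    unfolding T_def using measure_nonneg[of \<rho> "space \<rho>"] measure_nonneg[of \<sigma> "space \<sigma>"] by linarith+
  have d: "0 < d" "d < 1"
    using e T by (auto simp: d_def)
  have "d * T \<le> e / (2 * T) * T"
    unfolding d_def using T by (intro mult_right_mono) auto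
  then have dT: "d * T \<le> e / 2"
    using T by simp
  have sub: "K \<subseteq> dual_group" "L \<subseteq> dual_group"
    using compactin_subset_topspace[OF K(1)] compactin_subset_topspace[OF L(1)]
    by (simp_all add: topspace_dual_topology)
  obtain S c h where S: "finite S" "0 \<in> S"
    and h: "\<And>\<xi>. \<xi> \<in> bohr_dual \<Longrightarrow> complex_of_real (h \<xi>) = trig_poly S c \<xi>"
    and h01: "\<And>\<xi>. \<xi> \<in> bohr_dual \<Longrightarrow> h \<xi> \<in> {0..1}"
    and hK: "\<And>\<xi>. \<xi> \<in> K \<Longrightarrow> h \<xi> < d" and hL: "\<And>\<xi>. \<xi> \<in> L \<Longrightarrow> h \<xi> > 1 - d"
  proof (rule trig_poly_separates_compacts[of K L d])
    show "compact K" "compact L" "K \<subseteq> bohr_dual" "L \<subseteq> bohr_dual" "K \<inter> L = {}"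
      using K L AB(3) sub dual_group_subset_bohr_dual
      by (auto dest: compactin_dual_topology_imp_compact)
  qed (use d in auto)
  have p: "trig_poly S c \<xi> = of_real (h \<xi>)" "0 \<le> h \<xi>" "h \<xi> \<le> 1" if "\<xi> \<in> dual_group" for \<xi>
    using h[of \<xi>] h01[of \<xi>] that dual_group_subset_bohr_dual by auto
  have sq: "x\<^sup>2 \<le> x" if "0 \<le> x" "x \<le> 1" for x :: real
    using that by (simp add: power2_eq_square mult_left_le)
  have norms: "cmod (trig_poly S c \<xi>) = h \<xi>" "cmod (1 - trig_poly S c \<xi>) = 1 - h \<xi>"
    if "\<xi> \<in> dual_group" for \<xi>
  proof -
    have "1 - trig_poly S c \<xi> = of_real (1 - h \<xi>)"
      using p[OF that] by simp
    then show "cmod (1 - trig_poly S c \<xi>) = 1 - h \<xi>"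
      using p[OF that] by (simp only: norm_of_real)
    show "cmod (trig_poly S c \<xi>) = h \<xi>"
      using p[OF that] by simp
  qed
  have "(LINT \<xi>|\<rho>. (cmod (trig_poly S c \<xi>))\<^sup>2) \<le> d * measure \<rho> (space \<rho>) + measure \<rho> (space \<rho> - K)"
  proof (rule integral_le_small_off_compact[OF \<rho> K(1)])
    show "(\<lambda>\<xi>. (cmod (trig_poly S c \<xi>))\<^sup>2) \<in> borel_measurable \<rho>"
      using trig_poly_measurable[OF \<rho>, of S c] by measurable
    show "0 \<le> (cmod (trig_poly S c \<xi>))\<^sup>2 \<and> (cmod (trig_poly S c \<xi>))\<^sup>2 \<le> 1" if "\<xi> \<in> dual_group" for \<xi>
      using p[OF that] norms[OF that] by (simp add: power_le_one)
    show "(cmod (trig_poly S c \<xi>))\<^sup>2 \<le> d" if "\<xi> \<in> K" for \<xi>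
      using p[of \<xi>] norms[of \<xi>] sq[of "h \<xi>"] hK[OF that] that sub by force
  qed (use d in simp)
  also have "\<dots> < d * T + e / 2"
    using K(3) T d by (intro add_le_less_mono mult_left_mono) auto
  also have "\<dots> \<le> e"
    using dT by simp
  finally have 1: "(LINT \<xi>|\<rho>. (cmod (trig_poly S c \<xi>))\<^sup>2) < e" .
  have "(LINT \<xi>|\<sigma>. (cmod (1 - trig_poly S c \<xi>))\<^sup>2) \<le> d * measure \<sigma> (space \<sigma>) + measure \<sigma> (space \<sigma> - L)"
  proof (rule integral_le_small_off_compact[OF \<sigma> L(1)])
    show "(\<lambda>\<xi>. (cmod (1 - trig_poly S c \<xi>))\<^sup>2) \<in> borel_measurable \<sigma>"
      using trig_poly_measurable[OF \<sigma>, of S c] by measurable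
    show "0 \<le> (cmod (1 - trig_poly S c \<xi>))\<^sup>2 \<and> (cmod (1 - trig_poly S c \<xi>))\<^sup>2 \<le> 1"
      if "\<xi> \<in> dual_group" for \<xi>
      using p[OF that] norms[OF that] by (simp add: power_le_one)
    show "(cmod (1 - trig_poly S c \<xi>))\<^sup>2 \<le> d" if "\<xi> \<in> L" for \<xi>
      using p[of \<xi>] norms[of \<xi>] sq[of "1 - h \<xi>"] hL[OF that] that sub by force
  qed (use d in simp)
  also have "\<dots> < d * T + e / 2"
    using L(3) T d by (intro add_le_less_mono mult_left_mono) auto
  also have "\<dots> \<le> e"
    using dT by simp
  finally have 2: "(LINT \<xi>|\<sigma>. (cmod (1 - trig_poly S c \<xi>))\<^sup>2) < e" .
  show thesis
    by (rule that[OF S 1 2])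
qed

section \<open>Means along a van Hove sequence\<close>

lemma norm_integral_le:
  fixes f :: "'a \<Rightarrow> 'b::{banach, second_countable_topology}"
  assumes "integrable M f" "integrable M g" "\<And>x. norm (f x) \<le> g x"
  shows "norm (LINT x|M. f x) \<le> (LINT x|M. g x)"
  using assms by (intro order_trans[OF integral_norm_bound] integral_mono integrable_norm)

lemma haar_sets: "haar_measure \<mu> \<Longrightarrow> sets \<mu> = sets borel"
  by (simp add: haar_measure_def)

lemma haar_compact_finite: "haar_measure \<mu> \<Longrightarrow> compact K \<Longrightarrow> emeasure \<mu> K < \<infinity>"
  unfolding haar_measure_def by blast

lemma haar_translation:
  "haar_measure \<mu> \<Longrightarrow> B \<in> sets borel \<Longrightarrow> emeasure \<mu> ((\<lambda>s. t + s) ` B) = emeasure \<mu> B"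
  unfolding haar_measure_def by blast

lemma haar_measurable_continuous:
  fixes h :: "'g::topological_ab_group_add \<Rightarrow> complex"
  assumes "haar_measure \<mu>" "continuous_on UNIV h"
  shows "h \<in> borel_measurable \<mu>"
  using borel_measurable_continuous_onI[OF assms(2)] haar_sets[OF assms(1)]
  by (simp cong: measurable_cong_sets)

lemma haar_integral_shift:
  fixes k :: "'g::topological_ab_group_add \<Rightarrow> complex"
  assumes haar: "haar_measure \<mu>" and k: "k \<in> borel_measurable borel"
  shows "(LINT s|\<mu>. k (s + r)) = (LINT s|\<mu>. k s)"
proof -
  have sets: "sets \<mu> = sets borel"
    by (rule haar_sets[OF haar])
  have "(\<lambda>s. s + r) \<in> borel_measurable borel"
    by (intro borel_measurable_continuous_onI continuous_intros)
  then have meas: "(\<lambda>s. s + r) \<in> measurable \<mu> \<mu>"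
    using sets by (simp cong: measurable_cong_sets)
  have "distr \<mu> \<mu> (\<lambda>s. s + r) = \<mu>"
  proof (rule measure_eqI)
    fix B assume "B \<in> sets (distr \<mu> \<mu> (\<lambda>s. s + r))"
    then have B: "B \<in> sets \<mu>" by simp
    have "(\<lambda>s. s + r) -` B = (\<lambda>s. - r + s) ` B"
      by (force simp: algebra_simps)
    then have "emeasure \<mu> ((\<lambda>s. s + r) -` B) = emeasure \<mu> B"
      using haar_translation[OF haar, of B "- r"] B by (simp only: sets)
    then show "emeasure (distr \<mu> \<mu> (\<lambda>s. s + r)) B = emeasure \<mu> B"
      using emeasure_distr[OF meas B] sets_eq_imp_space_eq[OF sets] by simp
  qed simp
  moreover have "k \<in> borel_measurable \<mu>"
    using k sets by (simp cong: measurable_cong_sets)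
  ultimately show ?thesis
    using integral_distr[OF meas, of k] by simp
qed

lemma van_hove_sets:
  assumes haar: "haar_measure \<mu>" and vh: "van_hove_sequence \<mu> A"
  shows "A n \<in> sets \<mu>" and "emeasure \<mu> (A n) < \<infinity>"
proof -
  have A: "open (A n)" "compact (closure (A n))"
    using vh by (auto simp: van_hove_sequence_def)
  then show "A n \<in> sets \<mu>"
    by (simp add: haar_sets[OF haar])
  have "emeasure \<mu> (A n) \<le> emeasure \<mu> (closure (A n))"
    by (intro emeasure_mono closure_subset) (simp add: haar_sets[OF haar])
  also have "\<dots> < \<infinity>"
    by (rule haar_compact_finite[OF haar A(2)])
  finally show "emeasure \<mu> (A n) < \<infinity>" .
qed

lemma van_hove_set_integrable:
  fixes h :: "'g::topological_ab_group_add \<Rightarrow> complex"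
  assumes "haar_measure \<mu>" "van_hove_sequence \<mu> A" "continuous_on UNIV h" "\<And>s. cmod (h s) \<le> C"
  shows "set_integrable \<mu> (A n) h"
  unfolding set_integrable_def
  using van_hove_sets[OF assms(1,2)] haar_measurable_continuous[OF assms(1,3)] assms(4)
  by (intro integrableI_bounded_set_indicator) auto

lemma van_hove_boundary_singleton:
  fixes \<mu> :: "'g::{topological_ab_group_add, t2_space} measure"
  assumes haar: "haar_measure \<mu>" and vh: "van_hove_sequence \<mu> A"
  shows "van_hove_boundary {r} (A n) \<in> fmeasurable \<mu>"
proof -
  have A: "open (A n)" "compact (closure (A n))"
    using vh by (auto simp: van_hove_sequence_def)
  have shift: "{a + k | a k. a \<in> A n \<and> k \<in> {r}} = (\<lambda>s. s + r) ` A n"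
    "{b - k | b k. b \<in> - A n \<and> k \<in> {r}} = (\<lambda>s. s + r) -` (- A n)"
    by (auto simp: image_def) (metis add_diff_cancel_right')
  have comp: "compact ((\<lambda>s. s + r) ` closure (A n))"
    by (intro compact_continuous_image continuous_intros A)
  have sub: "closure ((\<lambda>s. s + r) ` A n) \<subseteq> (\<lambda>s. s + r) ` closure (A n)"
    using comp closure_subset[of "A n"] by (intro closure_minimal image_mono compact_imp_closed)
  have "closed ((\<lambda>s. s + r) -` (- A n))"
    using A by (intro closed_vimage continuous_intros) auto
  then have meas: "van_hove_boundary {r} (A n) \<in> sets borel"
    unfolding van_hove_boundary_def shift using A by auto
  let ?C = "(\<lambda>s. s + r) ` closure (A n) \<union> closure (A n)"
  have "compact ?C"
    using comp A by blast
  moreover have "van_hove_boundary {r} (A n) \<subseteq> ?C"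
    unfolding van_hove_boundary_def shift using sub by blast
  ultimately have "emeasure \<mu> (van_hove_boundary {r} (A n)) < \<infinity>"
    by (intro le_less_trans[OF emeasure_mono haar_compact_finite[OF haar]])
       (simp_all add: haar_sets[OF haar] borel_closed compact_imp_closed del: closed_Un sets.Un)
  then show ?thesis
    using meas haar_sets[OF haar] by (auto intro: fmeasurableI)
qed

text \<open>
  Shifting \<open>h\<close> amounts to shifting \<open>A n\<close>, and the symmetric difference of \<open>A n\<close> and its translate by \<open>r\<close>
  is covered by the van Hove boundaries of \<open>A n\<close> for the one-point sets \<open>{r}\<close> and \<open>{- r}\<close>.
\<close>

lemma set_mean_shift_tendsto:
  fixes \<mu> :: "'g::{topological_ab_group_add, t2_space} measure"
  assumes haar: "haar_measure \<mu>" and vh: "van_hove_sequence \<mu> A"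
    and h: "continuous_on UNIV h" and C: "\<And>s. cmod (h s) \<le> C"
  shows "(\<lambda>n. set_mean \<mu> (A n) (\<lambda>s. h (s + r)) - set_mean \<mu> (A n) h) \<longlonglongrightarrow> 0"
proof (rule Lim_null_comparison)
  let ?b = "\<lambda>r n. measure \<mu> (van_hove_boundary {r} (A n))"
  have lim: "(\<lambda>n. ?b r n / measure \<mu> (A n)) \<longlonglongrightarrow> 0" for r
    using vh by (simp add: van_hove_sequence_def)
  show "(\<lambda>n. C * (?b r n / measure \<mu> (A n) + ?b (- r) n / measure \<mu> (A n))) \<longlonglongrightarrow> 0"
    using tendsto_mult[OF tendsto_const[of C] tendsto_add[OF lim[of r] lim[of "- r"]]] by simp
  have "cmod (set_mean \<mu> (A n) (\<lambda>s. h (s + r)) - set_mean \<mu> (A n) h)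
      \<le> C * (?b r n / measure \<mu> (A n) + ?b (- r) n / measure \<mu> (A n))" for n
  proof -
    let ?I = "\<lambda>s. indicator (A n) s :: real"
    let ?k = "\<lambda>s. ?I (s - r) *\<^sub>R h s"
    have C0: "0 \<le> C"
      using C[of 0] norm_ge_zero order_trans by blast
    have pos: "measure \<mu> (A n) > 0"
      using vh by (simp add: van_hove_sequence_def)
    have A: "A n \<in> sets borel"
      using van_hove_sets[OF haar vh] haar_sets[OF haar] by simp
    have "(\<lambda>s. s - r) \<in> borel_measurable borel"
      by (intro borel_measurable_continuous_onI continuous_intros)
    then have "(\<lambda>s. ?I (s - r)) \<in> borel_measurable borel"
      using A by (intro measurable_compose[OF _ borel_measurable_indicator])
    then have meas: "?k \<in> borel_measurable borel"
      using borel_measurable_continuous_onI[OF h] by (intro borel_measurable_scaleR)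
    have shift: "(LINT s:A n|\<mu>. h (s + r)) = (LINT s|\<mu>. ?k s)"
      unfolding set_lebesgue_integral_def using haar_integral_shift[OF haar meas, of r] by simp
    have int1: "integrable \<mu> (\<lambda>s. ?I s *\<^sub>R h s)"
      using van_hove_set_integrable[OF haar vh h C] by (simp add: set_integrable_def)
    have "van_hove_boundary {t} (A n) \<in> fmeasurable \<mu>" for t
      by (rule van_hove_boundary_singleton[OF haar vh])
    then have fin: "van_hove_boundary {t} (A n) \<in> sets \<mu>" "emeasure \<mu> (van_hove_boundary {t} (A n)) < \<infinity>" for t
      by (auto simp: fmeasurable_def)
    let ?B = "\<lambda>s. C * (indicator (van_hove_boundary {r} (A n)) s + indicator (van_hove_boundary {- r} (A n)) s)"
    have intB: "integrable \<mu> ?B"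
      by (intro integrable_mult_right Bochner_Integration.integrable_add integrable_real_indicator fin)
    \<comment> \<open>A point lying in exactly one of \<open>A n\<close> and \<open>A n + r\<close> is in a boundary: for \<open>K = {r}\<close> if
      it has left \<open>A n\<close>, for \<open>K = {- r}\<close> if it has not been reached from \<open>A n\<close>.\<close>
    have le: "norm (?k s - ?I s *\<^sub>R h s) \<le> ?B s" for s
    proof -
      have 1: "s \<in> van_hove_boundary {r} (A n)" if "s - r \<in> A n" "s \<notin> A n"
      proof -
        have "s \<in> {a + k | a k. a \<in> A n \<and> k \<in> {r}}"
          using that(1) by (intro CollectI exI[of _ "s - r"] exI[of _ r]) simp
        then show ?thesis
          unfolding van_hove_boundary_def using that(2) by (intro UnI1 DiffI subsetD[OF closure_subset])
      qed
      have 2: "s \<in> van_hove_boundary {- r} (A n)" if "s - r \<notin> A n" "s \<in> A n"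
      proof -
        have "s \<in> {b - k | b k. b \<in> - A n \<and> k \<in> {- r}}"
          using that(1) by (intro CollectI exI[of _ "s - r"] exI[of _ "- r"]) simp
        then show ?thesis
          unfolding van_hove_boundary_def using that(2) by (intro UnI2 IntI subsetD[OF closure_subset])
      qed
      show ?thesis
        using 1 2 C[of s] C0 by (cases "s \<in> A n"; cases "s - r \<in> A n") (auto simp: indicator_def)
    qed
    have "integrable \<mu> (\<lambda>s. ?k s - ?I s *\<^sub>R h s)"
      by (rule Bochner_Integration.integrable_bound[OF intB])
         (use meas int1 haar_sets[OF haar] le C0 in \<open>auto cong: measurable_cong_sets intro!: borel_measurable_diff\<close>)
    then have int2: "integrable \<mu> ?k"
      using Bochner_Integration.integrable_add[OF _ int1] by fastforce
    have "cmod ((LINT s|\<mu>. ?k s) - (LINT s|\<mu>. ?I s *\<^sub>R h s)) = cmod (LINT s|\<mu>. ?k s - ?I s *\<^sub>R h s)"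
      using int1 int2 by simp
    also have "\<dots> \<le> (LINT s|\<mu>. ?B s)"
      using le by (intro norm_integral_le intB Bochner_Integration.integrable_diff int1 int2)
    also have "\<dots> = C * (?b r n + ?b (- r) n)"
      using fin by simp
    finally have "cmod ((LINT s:A n|\<mu>. h (s + r)) - (LINT s:A n|\<mu>. h s)) \<le> C * (?b r n + ?b (- r) n)"
      by (simp add: shift) (simp add: set_lebesgue_integral_def)
    then have "cmod ((LINT s:A n|\<mu>. h (s + r)) - (LINT s:A n|\<mu>. h s)) / measure \<mu> (A n)
        \<le> C * (?b r n + ?b (- r) n) / measure \<mu> (A n)"
      using pos by (intro divide_right_mono) simp_all
    moreover have "cmod (set_mean \<mu> (A n) (\<lambda>s. h (s + r)) - set_mean \<mu> (A n) h) =
        cmod ((LINT s:A n|\<mu>. h (s + r)) - (LINT s:A n|\<mu>. h s)) / measure \<mu> (A n)"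
      unfolding set_mean_def scaleR_diff_right[symmetric] norm_scaleR
      using pos by (simp add: divide_inverse)
    moreover have "C * (?b r n + ?b (- r) n) / measure \<mu> (A n) =
        C * (?b r n / measure \<mu> (A n) + ?b (- r) n / measure \<mu> (A n))"
      by (simp add: add_divide_distrib distrib_left)
    ultimately show ?thesis
      by simp
  qed
  then show "\<forall>\<^sub>F n in sequentially. cmod (set_mean \<mu> (A n) (\<lambda>s. h (s + r)) - set_mean \<mu> (A n) h)
      \<le> C * (?b r n / measure \<mu> (A n) + ?b (- r) n / measure \<mu> (A n))"
    by simp
qed

lemma set_mean_add:
  "set_integrable \<mu> S u \<Longrightarrow> set_integrable \<mu> S v \<Longrightarrow>
    set_mean \<mu> S (\<lambda>s. u s + v s) = set_mean \<mu> S u + set_mean \<mu> S v"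
  by (simp add: set_mean_def scaleR_add_right)

lemma set_mean_sum:
  assumes "\<And>i. i \<in> I \<Longrightarrow> set_integrable \<mu> S (u i)"
  shows "set_mean \<mu> S (\<lambda>s. \<Sum>i\<in>I. c i * u i s) = (\<Sum>i\<in>I. c i * set_mean \<mu> S (u i))"
proof -
  have "(LINT s:S|\<mu>. \<Sum>i\<in>I. c i * u i s) = (\<Sum>i\<in>I. LINT s:S|\<mu>. c i * u i s)"
    unfolding set_lebesgue_integral_def scaleR_sum_right
    using assms by (intro Bochner_Integration.integral_sum)
      (simp add: set_integrable_def mult_scaleR_right[symmetric] del: mult_scaleR_right)
  also have "\<dots> = (\<Sum>i\<in>I. c i * (LINT s:S|\<mu>. u i s))"
    by simp
  finally show ?thesis
    by (simp add: set_mean_def scaleR_sum_right)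
qed

lemma norm_set_mean_le:
  assumes "set_integrable \<mu> S u" "set_integrable \<mu> S v"
    and le: "\<And>s. cmod (u s) \<le> C * cmod (v s)"
  shows "cmod (set_mean \<mu> S u) \<le> C * cmod (set_mean \<mu> S (\<lambda>s. complex_of_real (cmod (v s))))"
proof -
  have int: "integrable \<mu> (\<lambda>s. indicator S s *\<^sub>R cmod (v s))"
    using assms(2) integrable_norm[of \<mu> "\<lambda>s. indicator S s *\<^sub>R v s"] by (simp add: set_integrable_def)
  have "cmod (LINT s:S|\<mu>. u s) \<le> (LINT s|\<mu>. C * (indicator S s *\<^sub>R cmod (v s)))"
    unfolding set_lebesgue_integral_def
  proof (rule norm_integral_le)
    show "integrable \<mu> (\<lambda>s. C * (indicator S s *\<^sub>R cmod (v s)))"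
      by (rule integrable_mult_right[OF int])
    show "norm (indicator S s *\<^sub>R u s) \<le> C * (indicator S s *\<^sub>R cmod (v s))" for s
      using le[of s] by (auto simp: indicator_def)
  qed (use assms(1) in \<open>simp add: set_integrable_def\<close>)
  also have "\<dots> = C * (LINT s|\<mu>. indicator S s *\<^sub>R cmod (v s))"
    by (rule integral_mult_right_zero)
  also have "(LINT s|\<mu>. indicator S s *\<^sub>R cmod (v s)) =
      cmod (complex_of_real (LINT s|\<mu>. indicator S s *\<^sub>R cmod (v s)))"
    by (simp add: Bochner_Integration.integral_nonneg)
  also have "complex_of_real (LINT s|\<mu>. indicator S s *\<^sub>R cmod (v s)) =
      (LINT s:S|\<mu>. complex_of_real (cmod (v s)))"
    unfolding set_lebesgue_integral_def
    by (subst integral_complex_of_real[symmetric]) (simp add: scaleR_conv_of_real)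
  finally have "inverse (measure \<mu> S) * cmod (LINT s:S|\<mu>. u s) \<le>
      inverse (measure \<mu> S) * (C * cmod (LINT s:S|\<mu>. complex_of_real (cmod (v s))))"
    by (rule mult_left_mono) simp
  then show ?thesis
    by (simp add: set_mean_def mult.left_commute)
qed

lemma set_mean_cmod_shift:
  fixes \<mu> :: "'g::{topological_ab_group_add, t2_space} measure"
  assumes "haar_measure \<mu>" "van_hove_sequence \<mu> A" "continuous_on UNIV w" "\<And>s. cmod (w s) \<le> C"
  shows "(\<lambda>n. set_mean \<mu> (A n) (\<lambda>s. complex_of_real (cmod (w (s + r)))) -
    set_mean \<mu> (A n) (\<lambda>s. complex_of_real (cmod (w s)))) \<longlonglongrightarrow> 0"
  by (rule set_mean_shift_tendsto[OF assms(1,2), where C = C]) (use assms(3,4) in \<open>auto intro!: continuous_intros\<close>)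

text \<open>
  Two functions are uncorrelated when, up to any given tolerance, some filter with finitely many coefficients \<open>c r\<close>
  nearly annihilates \<open>u\<close> in mean while its adjoint nearly fixes \<open>v\<close> in mean. Writing \<open>z\<close> for the filtered \<open>u\<close>
  and \<open>w\<close> for \<open>v\<close> minus the filtered \<open>v\<close>, the mean of \<open>u s * cnj (v (s - t))\<close> is that of
  \<open>u s * cnj (w (s - t))\<close> plus that of \<open>z s * cnj (v (s - t))\<close>, up to the shift error \<open>d\<close>.
\<close>

lemma reflected_mean_tendsto_zero:
  fixes \<mu> :: "'g::{topological_ab_group_add, t2_space} measure"
  assumes haar: "haar_measure \<mu>" and vh: "van_hove_sequence \<mu> A"
    and u: "continuous_on UNIV u" "\<And>s. cmod (u s) \<le> C"
    and v: "continuous_on UNIV v" "\<And>s. cmod (v s) \<le> D"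
    and filter: "\<And>e. 0 < e \<Longrightarrow> \<exists>S c. finite S \<and>
      (\<forall>\<^sub>F n in sequentially.
        cmod (set_mean \<mu> (A n) (\<lambda>s. complex_of_real (cmod (\<Sum>r\<in>S. c r * u (s - r))))) < e) \<and>
      (\<forall>\<^sub>F n in sequentially.
        cmod (set_mean \<mu> (A n) (\<lambda>s. complex_of_real (cmod (v s - (\<Sum>r\<in>S. cnj (c r) * v (s + r)))))) < e)"
  shows "(\<lambda>n. set_mean \<mu> (A n) (\<lambda>s. u s * cnj (v (s - t)))) \<longlonglongrightarrow> 0"
proof (rule tendstoI)
  fix \<epsilon> :: real assume \<epsilon>: "0 < \<epsilon>"
  have C0: "0 \<le> C" and D0: "0 \<le> D"
    using u(2)[of 0] v(2)[of 0] norm_ge_zero order_trans by blast+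
  \<comment> \<open>With every error term below \<open>e\<close>, the final bound is \<open>(2 * C + D + 1) * e\<close>.\<close>
  define e where "e = \<epsilon> / (2 * C + D + 2)"
  have e: "0 < e"
    using \<epsilon> C0 D0 by (simp add: e_def)
  obtain S c where S: "finite S"
    and z_small: "\<forall>\<^sub>F n in sequentially.
        cmod (set_mean \<mu> (A n) (\<lambda>s. complex_of_real (cmod (\<Sum>r\<in>S. c r * u (s - r))))) < e"
    and w_small: "\<forall>\<^sub>F n in sequentially.
        cmod (set_mean \<mu> (A n) (\<lambda>s. complex_of_real (cmod (v s - (\<Sum>r\<in>S. cnj (c r) * v (s + r)))))) < e"
    using filter[OF e] by blast
  define z where "z s = (\<Sum>r\<in>S. c r * u (s - r))" for s
  define w where "w s = v s - (\<Sum>r\<in>S. cnj (c r) * v (s + r))" for s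
  \<comment> \<open>Shifting \<open>q r\<close> by \<open>r\<close> moves the translation by \<open>r\<close> from \<open>u\<close> to \<open>v\<close>.\<close>
  define q where "q r s = u (s - r) * cnj (v (s - t))" for r s
  define M where "M k n = set_mean \<mu> (A n) k" for k n
  have comp: "continuous_on UNIV (\<lambda>s. k (s + r))" "continuous_on UNIV (\<lambda>s. k (s - r))"
    if "continuous_on UNIV k" for k :: "'g \<Rightarrow> complex" and r
    by (rule continuous_on_compose2[OF that], auto intro!: continuous_intros)+
  have z: "continuous_on UNIV z"
    unfolding z_def by (intro continuous_intros comp u)
  have z_le: "cmod (z s) \<le> (\<Sum>r\<in>S. cmod (c r) * C)" for s
    unfolding z_def by (intro sum_norm_le) (simp add: norm_mult mult_left_mono u)
  have w: "continuous_on UNIV w"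
    unfolding w_def by (intro continuous_intros comp v)
  have w_le: "cmod (w s) \<le> D + (\<Sum>r\<in>S. cmod (c r) * D)" for s
    unfolding w_def by (intro order_trans[OF norm_triangle_ineq4] add_mono v sum_norm_le)
      (simp add: norm_mult mult_left_mono v)
  have q: "continuous_on UNIV (q r)" for r
    unfolding q_def by (intro continuous_intros comp u v)
  have q_le: "cmod (q r s) \<le> C * D" for r s
    unfolding q_def by (simp add: norm_mult mult_mono u v C0)
  have bdd: "set_integrable \<mu> (A n) k" if "continuous_on UNIV k" "\<And>s. cmod (k s) \<le> B" for k B n
    by (rule van_hove_set_integrable[OF haar vh that])
  have uw_le: "cmod (u s * cnj (w (s - t))) \<le> C * cmod (w (s - t))" for s
    by (simp add: norm_mult mult_right_mono u)
  have zv_le: "cmod (z s * cnj (v (s - t))) \<le> D * cmod (z s)" for s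
    by (simp add: norm_mult mult.commute[of D] mult_left_mono v)
  have int_uw: "set_integrable \<mu> (A n) (\<lambda>s. u s * cnj (w (s - t)))" for n
    by (rule bdd[where B = "C * (D + (\<Sum>r\<in>S. cmod (c r) * D))"])
      (intro continuous_intros comp u w order_trans[OF uw_le] mult_left_mono w_le C0)+
  have int_zv: "set_integrable \<mu> (A n) (\<lambda>s. z s * cnj (v (s - t)))" for n
    by (rule bdd[where B = "D * (\<Sum>r\<in>S. cmod (c r) * C)"])
      (intro continuous_intros comp v z order_trans[OF zv_le] mult_left_mono z_le D0)+
  have int_q: "set_integrable \<mu> (A n) (\<lambda>s. q r (s + r))" for r n
    by (rule bdd[where B = "C * D"]) (intro comp q q_le)+
  have int_sum: "set_integrable \<mu> (A n) (\<lambda>s. \<Sum>r\<in>S. c r * q r (s + r))" for n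
    by (rule bdd[where B = "\<Sum>r\<in>S. cmod (c r) * (C * D)"])
      (intro continuous_intros comp q, intro sum_norm_le, simp add: norm_mult mult_left_mono q_le)
  define d where "d n = (\<Sum>r\<in>S. c r * (M (\<lambda>s. q r (s + r)) n - M (q r) n))" for n
  have "(\<lambda>n. M (\<lambda>s. q r (s + r)) n - M (q r) n) \<longlonglongrightarrow> 0" for r
    unfolding M_def by (rule set_mean_shift_tendsto[OF haar vh q q_le])
  then have d: "d \<longlonglongrightarrow> 0"
    unfolding d_def by (intro tendsto_null_sum tendsto_mult_right_zero)
  define \<delta> where "\<delta> n = M (\<lambda>s. complex_of_real (cmod (w (s + - t)))) n -
    M (\<lambda>s. complex_of_real (cmod (w s))) n" for n
  have \<delta>: "\<delta> \<longlonglongrightarrow> 0"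
    unfolding \<delta>_def M_def by (rule set_mean_cmod_shift[OF haar vh w w_le])
  have split: "M (\<lambda>s. u s * cnj (v (s - t))) n =
      M (\<lambda>s. u s * cnj (w (s - t))) n + M (\<lambda>s. z s * cnj (v (s - t))) n + d n" for n
  proof -
    have "(\<lambda>s. u s * cnj (v (s - t))) =
        (\<lambda>s. u s * cnj (w (s - t)) + (\<Sum>r\<in>S. c r * q r (s + r)))"
      by (rule ext) (simp add: w_def q_def algebra_simps sum_distrib_left)
    then have "M (\<lambda>s. u s * cnj (v (s - t))) n =
        M (\<lambda>s. u s * cnj (w (s - t))) n + M (\<lambda>s. \<Sum>r\<in>S. c r * q r (s + r)) n"
      unfolding M_def
      by (simp add: set_mean_add[OF int_uw int_sum])
    also have "M (\<lambda>s. \<Sum>r\<in>S. c r * q r (s + r)) n = (\<Sum>r\<in>S. c r * M (\<lambda>s. q r (s + r)) n)"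
      unfolding M_def by (rule set_mean_sum[OF int_q])
    also have "\<dots> = (\<Sum>r\<in>S. c r * M (q r) n) + d n"
      by (simp add: d_def sum.distrib[symmetric] algebra_simps)
    also have "(\<Sum>r\<in>S. c r * M (q r) n) = M (\<lambda>s. \<Sum>r\<in>S. c r * q r s) n"
      unfolding M_def by (rule set_mean_sum[symmetric]) (rule bdd[OF q q_le])
    also have "(\<lambda>s. \<Sum>r\<in>S. c r * q r s) = (\<lambda>s. z s * cnj (v (s - t)))"
      by (rule ext) (simp add: z_def q_def sum_distrib_right mult.assoc)
    finally show ?thesis
      by simp
  qed
  have bound: "cmod (M (\<lambda>s. u s * cnj (v (s - t))) n) \<le>
      C * (cmod (M (\<lambda>s. complex_of_real (cmod (w s))) n) + cmod (\<delta> n)) +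
      D * cmod (M (\<lambda>s. complex_of_real (cmod (z s))) n) + cmod (d n)" for n
  proof -
    have "cmod (M (\<lambda>s. u s * cnj (w (s - t))) n) \<le> C * cmod (M (\<lambda>s. complex_of_real (cmod (w (s - t)))) n)"
      unfolding M_def
      by (rule norm_set_mean_le[OF int_uw bdd[OF comp(2)[OF w] w_le] uw_le])
    also have "M (\<lambda>s. complex_of_real (cmod (w (s - t)))) n = M (\<lambda>s. complex_of_real (cmod (w s))) n + \<delta> n"
      by (simp add: \<delta>_def)
    also have "C * cmod \<dots> \<le> C * (cmod (M (\<lambda>s. complex_of_real (cmod (w s))) n) + cmod (\<delta> n))"
      by (intro mult_left_mono norm_triangle_ineq C0)
    finally have 1: "cmod (M (\<lambda>s. u s * cnj (w (s - t))) n) \<le>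
      C * (cmod (M (\<lambda>s. complex_of_real (cmod (w s))) n) + cmod (\<delta> n))" .
    have 2: "cmod (M (\<lambda>s. z s * cnj (v (s - t))) n) \<le> D * cmod (M (\<lambda>s. complex_of_real (cmod (z s))) n)"
      unfolding M_def by (rule norm_set_mean_le[OF int_zv bdd[OF z z_le] zv_le])
    show ?thesis
      unfolding split
      by (intro order_trans[OF norm_triangle_ineq] add_mono 1 2 order_refl)
  qed
  have small: "\<forall>\<^sub>F n in sequentially. cmod (\<delta> n) < e" "\<forall>\<^sub>F n in sequentially. cmod (d n) < e"
    using tendstoD[OF \<delta> e] tendstoD[OF d e] by (simp_all add: dist_norm)
  show "\<forall>\<^sub>F n in sequentially. dist (set_mean \<mu> (A n) (\<lambda>s. u s * cnj (v (s - t)))) 0 < \<epsilon>"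
    using small z_small w_small
  proof eventually_elim
    case (elim n)
    have "cmod (M (\<lambda>s. u s * cnj (v (s - t))) n) \<le> C * (e + e) + D * e + e"
      using elim unfolding z_def[symmetric] w_def[symmetric] M_def[symmetric]
      by (intro order_trans[OF bound] add_mono mult_left_mono C0 D0 less_imp_le)
    also have "\<dots> < e * (2 * C + D + 2)"
      using e by (simp add: algebra_simps)
    also have "\<dots> = \<epsilon>"
      using C0 D0 by (simp add: e_def)
    finally show ?case
      by (simp add: M_def)
  qed
qed

section \<open>Spectral measures and Birkhoff averages of a dynamical system\<close>

lemma dynamical_systemD:
  assumes "dynamical_system \<alpha> m"
  shows "compact (UNIV :: 'x::t2_space set)"
    "continuous_on UNIV (\<lambda>(t, x :: 'x). \<alpha> (t :: 'g::topological_ab_group_add) x)"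
    "\<alpha> 0 x = x" "\<alpha> (s + t) x = \<alpha> s (\<alpha> t x)" "sets m = sets borel" "prob_space m"
    "B \<in> sets m \<Longrightarrow> emeasure m (\<alpha> t -` B) = emeasure m B"
  using assms unfolding dynamical_system_def by blast+

lemma dynamical_system_continuous:
  fixes \<alpha> :: "'g::topological_ab_group_add \<Rightarrow> 'x::t2_space \<Rightarrow> 'x"
  assumes "dynamical_system \<alpha> m"
  shows "continuous_on UNIV (\<alpha> t)" and "continuous_on UNIV (\<lambda>t. \<alpha> t x)"
proof -
  have cont: "continuous_on UNIV (\<lambda>p. \<alpha> (fst p) (snd p))"
    using dynamical_systemD(2)[OF assms] by (simp add: case_prod_beta')
  show "continuous_on UNIV (\<alpha> t)"
    using continuous_on_compose2[OF cont, of UNIV "\<lambda>x. (t, x)"] by (simp add: continuous_intros)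
  show "continuous_on UNIV (\<lambda>t. \<alpha> t x)"
    using continuous_on_compose2[OF cont, of UNIV "\<lambda>t. (t, x)"] by (simp add: continuous_intros)
qed

text \<open>
  Continuous functions on the compact space are bounded.
\<close>

lemma dynamical_system_integrable:
  fixes h :: "'x::t2_space \<Rightarrow> 'b::{banach, second_countable_topology}"
  assumes ds: "dynamical_system (\<alpha> :: 'g::topological_ab_group_add \<Rightarrow> 'x \<Rightarrow> 'x) m"
    and h: "continuous_on UNIV h"
  shows "integrable m h"
proof -
  interpret prob_space m
    by (rule dynamical_systemD[OF ds])
  have "bounded (range h)"
    by (intro compact_imp_bounded compact_continuous_image h dynamical_systemD(1)[OF ds])
  then obtain C where "norm (h x) \<le> C" for x
    by (auto simp: bounded_iff)
  moreover have "h \<in> borel_measurable m"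
    using borel_measurable_continuous_onI[OF h] dynamical_systemD(5)[OF ds]
    by (simp cong: measurable_cong_sets)
  ultimately show ?thesis
    by (intro integrable_const_bound[where B = C]) auto
qed

lemma dynamical_system_integral_shift:
  fixes h :: "'x::t2_space \<Rightarrow> complex"
  assumes ds: "dynamical_system (\<alpha> :: 'g::topological_ab_group_add \<Rightarrow> 'x \<Rightarrow> 'x) m"
    and h: "continuous_on UNIV h"
  shows "(LINT x|m. h (\<alpha> t x)) = (LINT x|m. h x)"
proof -
  have sets: "sets m = sets borel"
    by (rule dynamical_systemD[OF ds])
  have meas: "\<alpha> t \<in> measurable m m"
    using borel_measurable_continuous_onI[OF dynamical_system_continuous(1)[OF ds]] sets
    by (simp cong: measurable_cong_sets)
  have "distr m m (\<alpha> t) = m"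
  proof (rule measure_eqI)
    fix B assume "B \<in> sets (distr m m (\<alpha> t))"
    then have "B \<in> sets m" by simp
    then show "emeasure (distr m m (\<alpha> t)) B = emeasure m B"
      using emeasure_distr[OF meas, of B] dynamical_systemD(7)[OF ds] sets_eq_imp_space_eq[OF sets]
      by simp
  qed simp
  moreover have "h \<in> borel_measurable m"
    using borel_measurable_continuous_onI[OF h] sets by (simp cong: measurable_cong_sets)
  ultimately show ?thesis
    using integral_distr[OF meas, of h] by simp
qed

text \<open>
  By invariance of \<open>m\<close> the correlation depends on \<open>t - s\<close> only, and there the spectral measure gives it.
\<close>

lemma spectral_correlation:
  fixes f :: "'x::t2_space \<Rightarrow> complex"
  assumes ds: "dynamical_system (\<alpha> :: 'g::topological_ab_group_add \<Rightarrow> 'x \<Rightarrow> 'x) m"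
    and f: "continuous_on UNIV f" and spec: "is_spectral_measure \<alpha> m f \<sigma>"
  shows "(LINT x|m. f (\<alpha> s x) * cnj (f (\<alpha> t x))) = (LINT \<xi>|\<sigma>. \<xi> (- s) * cnj (\<xi> (- t)))"
proof -
  have cont: "continuous_on UNIV (\<lambda>x. f (\<alpha> r x))" for r
    by (rule continuous_on_compose2[OF f dynamical_system_continuous(1)[OF ds]]) auto
  have "\<alpha> (t - s) (\<alpha> s x) = \<alpha> t x" for x
    using dynamical_systemD(4)[OF ds, of "t - s" s x] by simp
  then have "(LINT x|m. f (\<alpha> s x) * cnj (f (\<alpha> t x))) =
      (LINT x|m. f (\<alpha> s x) * cnj (f (\<alpha> (t - s) (\<alpha> s x))))"
    by simp
  also have "\<dots> = (LINT x|m. f x * cnj (f (\<alpha> (t - s) x)))"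
    by (rule dynamical_system_integral_shift[OF ds]) (intro continuous_intros f cont)
  also have "\<dots> = (LINT \<xi>|\<sigma>. \<xi> (t - s))"
    using spec by (simp add: is_spectral_measure_def L2_inner_def koopman_def)
  also have "\<dots> = (LINT \<xi>|\<sigma>. \<xi> (- s) * cnj (\<xi> (- t)))"
  proof (rule Bochner_Integration.integral_cong[OF refl])
    fix \<xi> assume "\<xi> \<in> space \<sigma>"
    then have "\<xi> \<in> bohr_dual"
      using spec dual_group_subset_bohr_dual finite_radon_dualD(3)
      by (auto simp: is_spectral_measure_def)
    then show "\<xi> (t - s) = \<xi> (- s) * cnj (\<xi> (- t))"
      using bohr_dualD(2)[of \<xi> "- s" t] bohr_dualD(4)[of \<xi> t] by simp
  qed
  finally show ?thesis .
qed

text \<open>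
  Expand both squares as double sums and compare them term by term with \<open>spectral_correlation\<close>.
\<close>

lemma spectral_isometry:
  fixes f :: "'x::t2_space \<Rightarrow> complex"
  assumes ds: "dynamical_system (\<alpha> :: 'g::topological_ab_group_add \<Rightarrow> 'x \<Rightarrow> 'x) m"
    and f: "continuous_on UNIV f" and spec: "is_spectral_measure \<alpha> m f \<sigma>"
  shows "(LINT x|m. (cmod (\<Sum>i\<in>I. c i * f (\<alpha> (\<tau> i) x)))\<^sup>2) =
    (LINT \<xi>|\<sigma>. (cmod (\<Sum>i\<in>I. c i * \<xi> (- \<tau> i)))\<^sup>2)"
proof -
  have rad: "finite_radon_dual \<sigma>"
    using spec by (simp add: is_spectral_measure_def)
  interpret finite_measure \<sigma>
    by (rule finite_radon_dualD[OF rad])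
  have cont: "continuous_on UNIV (\<lambda>x. f (\<alpha> r x))" for r
    by (rule continuous_on_compose2[OF f dynamical_system_continuous(1)[OF ds]]) auto
  have int_m: "integrable m (\<lambda>x. f (\<alpha> s x) * cnj (f (\<alpha> t x)))" for s t
    by (rule dynamical_system_integrable[OF ds]) (intro continuous_intros cont)
  have meas: "(\<lambda>\<xi>. \<xi> t) \<in> borel_measurable \<sigma>" for t
    using measurable_evaluation_dual_borel[of t] finite_radon_dualD(2)[OF rad]
    by (simp cong: measurable_cong_sets)
  have unit: "cmod (\<xi> t) = 1" if "\<xi> \<in> space \<sigma>" for \<xi> t
    using that finite_radon_dualD(3)[OF rad] by (simp add: dual_group_def)
  have int_\<sigma>: "integrable \<sigma> (\<lambda>\<xi>. \<xi> s * cnj (\<xi> t))" for s t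
  proof (rule integrable_const_bound[where B = 1])
    show "(\<lambda>\<xi>. \<xi> s * cnj (\<xi> t)) \<in> borel_measurable \<sigma>"
      by (intro borel_measurable_times meas
          measurable_compose[OF meas borel_measurable_continuous_onI[OF continuous_on_cnj[OF continuous_on_id]]])
  qed (simp add: norm_mult unit)
  have expand: "complex_of_real ((cmod (\<Sum>i\<in>I. c i * z i))\<^sup>2) =
      (\<Sum>i\<in>I. \<Sum>j\<in>I. c i * cnj (c j) * (z i * cnj (z j)))" for z
    by (simp add: complex_norm_square sum_product cnj_sum mult_ac del: of_real_power)
  have "complex_of_real (LINT x|m. (cmod (\<Sum>i\<in>I. c i * f (\<alpha> (\<tau> i) x)))\<^sup>2) =
      (LINT x|m. (\<Sum>i\<in>I. \<Sum>j\<in>I. c i * cnj (c j) * (f (\<alpha> (\<tau> i) x) * cnj (f (\<alpha> (\<tau> j) x)))))"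
    unfolding integral_complex_of_real[symmetric] expand ..
  also have "\<dots> = (\<Sum>i\<in>I. \<Sum>j\<in>I. c i * cnj (c j) * (LINT x|m. f (\<alpha> (\<tau> i) x) * cnj (f (\<alpha> (\<tau> j) x))))"
    by (simp add: int_m Bochner_Integration.integral_sum Bochner_Integration.integrable_sum
        del: mult.assoc)
  also have "\<dots> = (\<Sum>i\<in>I. \<Sum>j\<in>I. c i * cnj (c j) * (LINT \<xi>|\<sigma>. \<xi> (- \<tau> i) * cnj (\<xi> (- \<tau> j))))"
    by (simp only: spectral_correlation[OF ds f spec])
  also have "\<dots> = (LINT \<xi>|\<sigma>. (\<Sum>i\<in>I. \<Sum>j\<in>I. c i * cnj (c j) * (\<xi> (- \<tau> i) * cnj (\<xi> (- \<tau> j)))))"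
    by (simp add: int_\<sigma> Bochner_Integration.integral_sum Bochner_Integration.integrable_sum
        del: mult.assoc)
  also have "\<dots> = complex_of_real (LINT \<xi>|\<sigma>. (cmod (\<Sum>i\<in>I. c i * \<xi> (- \<tau> i)))\<^sup>2)"
    unfolding integral_complex_of_real[symmetric] expand ..
  finally show ?thesis
    by (simp only: of_real_eq_iff)
qed

text \<open>
  Birkhoff's theorem is applied to \<open>\<bar>F\<bar>\<close>, because the first absolute moment along the orbit is what
  controls the product of \<open>F\<close> with a bounded function.
\<close>

lemma birkhoff_mean_cmod_small:
  fixes F :: "'x::t2_space \<Rightarrow> complex"
  assumes ds: "dynamical_system (\<alpha> :: 'g::topological_ab_group_add \<Rightarrow> 'x \<Rightarrow> 'x) m"
    and birk: "birkhoff_holds \<mu> A \<alpha> m" and F: "continuous_on UNIV F"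
    and d: "0 < d" and L2: "(LINT x|m. (cmod (F x))\<^sup>2) < d\<^sup>2"
  shows "AE x in m. \<forall>\<^sub>F n in sequentially.
    cmod (set_mean \<mu> (A n) (\<lambda>s. complex_of_real (cmod (F (\<alpha> s x))))) < d"
proof -
  interpret prob_space m
    by (rule dynamical_systemD[OF ds])
  have int2: "integrable m (\<lambda>x. (cmod (F x))\<^sup>2)" and int1: "integrable m (\<lambda>x. cmod (F x))"
    by (intro dynamical_system_integrable[OF ds] continuous_intros F)+
  \<comment> \<open>The arithmetic-geometric mean inequality, in place of Cauchy-Schwarz.\<close>
  have "(LINT x|m. cmod (F x)) \<le> (LINT x|m. ((cmod (F x))\<^sup>2 + d\<^sup>2) / (2 * d))"
  proof (rule integral_mono[OF int1])
    show "integrable m (\<lambda>x. ((cmod (F x))\<^sup>2 + d\<^sup>2) / (2 * d))"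
      using int2 by simp
    show "cmod (F x) \<le> ((cmod (F x))\<^sup>2 + d\<^sup>2) / (2 * d)" for x
      using d zero_le_power2[of "cmod (F x) - d"] by (simp add: field_simps power2_eq_square)
  qed
  also have "\<dots> = ((LINT x|m. (cmod (F x))\<^sup>2) + d\<^sup>2) / (2 * d)"
    using int2 by (simp add: prob_space)
  also have "\<dots> < d"
    using L2 d by (simp add: field_simps power2_eq_square)
  finally have less: "cmod (LINT x|m. complex_of_real (cmod (F x))) < d"
    by (simp add: Bochner_Integration.integral_nonneg)
  have "integrable m (\<lambda>x. complex_of_real (cmod (F x)))"
    by (intro dynamical_system_integrable[OF ds] continuous_intros F)
  then have "AE x in m. (\<lambda>n. set_mean \<mu> (A n) (\<lambda>s. complex_of_real (cmod (F (\<alpha> s x)))))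
      \<longlonglongrightarrow> (LINT x|m. complex_of_real (cmod (F x)))"
    using birk unfolding birkhoff_holds_def by fastforce
  then show ?thesis
  proof (rule AE_mp, intro AE_I2 impI)
    fix x
    assume "(\<lambda>n. set_mean \<mu> (A n) (\<lambda>s. complex_of_real (cmod (F (\<alpha> s x)))))
      \<longlonglongrightarrow> (LINT x|m. complex_of_real (cmod (F x)))"
    from order_tendstoD(2)[OF tendsto_norm[OF this] less]
    show "\<forall>\<^sub>F n in sequentially. cmod (set_mean \<mu> (A n) (\<lambda>s. complex_of_real (cmod (F (\<alpha> s x))))) < d" .
  qed
qed

section \<open>Mutually singular spectral measures\<close>

lemma AE_pair_of_AE:
  assumes "prob_space M" "prob_space N" and P: "AE x in M. P x" and Q: "AE y in N. Q y"
  shows "AE (x, y) in M \<Otimes>\<^sub>M N. P x \<and> Q y"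
proof -
  interpret M: prob_space M by fact
  interpret N: prob_space N by fact
  interpret pair_prob_space M N ..
  obtain U where U: "{x \<in> space M. \<not> P x} \<subseteq> U" "emeasure M U = 0" "U \<in> sets M"
    using P by (auto elim: AE_E)
  obtain V where V: "{y \<in> space N. \<not> Q y} \<subseteq> V" "emeasure N V = 0" "V \<in> sets N"
    using Q by (auto elim: AE_E)
  have null: "U \<in> null_sets M" "V \<in> null_sets N"
    using U V by auto
  have "AE z in M \<Otimes>\<^sub>M N. fst z \<notin> U \<and> snd z \<notin> V"
  proof (rule AE_pair_measure)
    have "{z \<in> space (M \<Otimes>\<^sub>M N). fst z \<notin> U \<and> snd z \<notin> V} = (space M - U) \<times> (space N - V)"
      by (auto simp: space_pair_measure)
    then show "{z \<in> space (M \<Otimes>\<^sub>M N). fst z \<notin> U \<and> snd z \<notin> V} \<in> sets (M \<Otimes>\<^sub>M N)"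
      using U V by simp
    show "AE x in M. AE y in N. fst (x, y) \<notin> U \<and> snd (x, y) \<notin> V"
      using AE_not_in[OF null(1)] AE_not_in[OF null(2)] by (auto elim!: AE_mp intro!: AE_I2)
  qed
  then show ?thesis
    by (rule AE_mp, intro AE_I2) (use U V in \<open>auto simp: space_pair_measure\<close>)
qed

lemma orbit_fun_regular:
  fixes f :: "'x::t2_space \<Rightarrow> complex"
  assumes ds: "dynamical_system (\<alpha> :: 'g::topological_ab_group_add \<Rightarrow> 'x \<Rightarrow> 'x) m"
    and f: "continuous_on UNIV f"
  shows "continuous_on UNIV (orbit_fun \<alpha> f x)" and "\<exists>C. \<forall>x s. cmod (orbit_fun \<alpha> f x s) \<le> C"
proof -
  show "continuous_on UNIV (orbit_fun \<alpha> f x)"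
    unfolding orbit_fun_def[abs_def]
    by (rule continuous_on_compose2[OF f dynamical_system_continuous(2)[OF ds]]) auto
  have "bounded (range f)"
    by (intro compact_imp_bounded compact_continuous_image f dynamical_systemD(1)[OF ds])
  then show "\<exists>C. \<forall>x s. cmod (orbit_fun \<alpha> f x s) \<le> C"
    by (auto simp: bounded_iff orbit_fun_def)
qed

text \<open>
  The multiplier of the filter \<open>c\<close> on \<open>f\<close> is the polynomial \<open>p\<close> itself, that of its adjoint on \<open>g\<close> is the
  conjugate of \<open>p\<close>; so \<open>F\<close> corresponds to \<open>p\<close> in \<open>L\<^sup>2(\<rho>)\<close> and \<open>H\<close> to the conjugate of \<open>1 - p\<close> in \<open>L\<^sup>2(\<sigma>)\<close>.
\<close>

lemma filtered_orbits_small: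
  fixes f :: "'x::t2_space \<Rightarrow> complex" and g :: "'y::t2_space \<Rightarrow> complex"
    and \<alpha> :: "'g::topological_ab_group_add \<Rightarrow> 'x \<Rightarrow> 'x" and \<alpha>' :: "'g \<Rightarrow> 'y \<Rightarrow> 'y"
  assumes ds: "dynamical_system \<alpha> m" "dynamical_system \<alpha>' m'"
    and birk: "birkhoff_holds \<mu> A \<alpha> m" "birkhoff_holds \<mu> A \<alpha>' m'"
    and f: "continuous_on UNIV f" and g: "continuous_on UNIV g"
    and spec: "is_spectral_measure \<alpha> m f \<rho>" "is_spectral_measure \<alpha>' m' g \<sigma>"
    and sing: "mutually_singular \<rho> \<sigma>" and e: "0 < e"
  obtains S c where "finite S"
    "AE x in m. \<forall>\<^sub>F n in sequentially. cmod (set_mean \<mu> (A n)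
      (\<lambda>s. complex_of_real (cmod (\<Sum>r\<in>S. c r * orbit_fun \<alpha> f x (s - r))))) < e"
    "AE y in m'. \<forall>\<^sub>F n in sequentially. cmod (set_mean \<mu> (A n)
      (\<lambda>s. complex_of_real (cmod (orbit_fun \<alpha>' g y s - (\<Sum>r\<in>S. cnj (c r) * orbit_fun \<alpha>' g y (s + r)))))) < e"
proof -
  have rad: "finite_radon_dual \<rho>" "finite_radon_dual \<sigma>"
    using spec by (simp_all add: is_spectral_measure_def)
  obtain S c where S: "finite S" "0 \<in> S"
    and \<rho>: "(LINT \<xi>|\<rho>. (cmod (trig_poly S c \<xi>))\<^sup>2) < e\<^sup>2"
    and \<sigma>: "(LINT \<xi>|\<sigma>. (cmod (1 - trig_poly S c \<xi>))\<^sup>2) < e\<^sup>2"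
    by (rule mutually_singular_trig_poly[OF rad sing, of "e\<^sup>2"]) (use e in auto)
  define F where "F x = (\<Sum>r\<in>S. c r * f (\<alpha> (- r) x))" for x
  define d where "d r = cnj ((if r = 0 then 1 else 0) - c r)" for r
  define H where "H y = (\<Sum>r\<in>S. d r * g (\<alpha>' r y))" for y
  have F: "continuous_on UNIV F"
    unfolding F_def
    by (intro continuous_intros continuous_on_compose2[OF f dynamical_system_continuous(1)[OF ds(1)]]) auto
  have H: "continuous_on UNIV H"
    unfolding H_def
    by (intro continuous_intros continuous_on_compose2[OF g dynamical_system_continuous(1)[OF ds(2)]]) auto
  \<comment> \<open>The coefficient \<open>d\<close> absorbs \<open>g\<close> itself as the term of frequency 0, which is in \<open>S\<close>.\<close>
  have delta: "(\<Sum>r\<in>S. (if r = 0 then 1 else 0) * k r) = k 0" for k :: "'g \<Rightarrow> complex"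
    using S by (simp add: if_distrib[of "\<lambda>z. z * _"] cong: if_cong)
  have H_eq: "H y = g y - (\<Sum>r\<in>S. cnj (c r) * g (\<alpha>' r y))" for y
    using delta[of "\<lambda>r. g (\<alpha>' r y)"] dynamical_systemD(3)[OF ds(2)]
    by (simp add: H_def d_def left_diff_distrib sum_subtractf if_distrib[of cnj] cong: if_cong)
  have "(LINT x|m. (cmod (F x))\<^sup>2) = (LINT \<xi>|\<rho>. (cmod (trig_poly S c \<xi>))\<^sup>2)"
    unfolding F_def spectral_isometry[OF ds(1) f spec(1)] trig_poly_def by simp
  then have F_small: "(LINT x|m. (cmod (F x))\<^sup>2) < e\<^sup>2"
    using \<rho> by simp
  have "(LINT y|m'. (cmod (H y))\<^sup>2) = (LINT \<xi>|\<sigma>. (cmod (\<Sum>r\<in>S. d r * \<xi> (- r)))\<^sup>2)"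
    unfolding H_def by (rule spectral_isometry[OF ds(2) g spec(2)])
  also have "\<dots> = (LINT \<xi>|\<sigma>. (cmod (1 - trig_poly S c \<xi>))\<^sup>2)"
  proof (rule Bochner_Integration.integral_cong[OF refl])
    fix \<xi> assume "\<xi> \<in> space \<sigma>"
    then have \<xi>: "\<xi> \<in> bohr_dual"
      using finite_radon_dualD(3)[OF rad(2)] dual_group_subset_bohr_dual by auto
    have "(\<Sum>r\<in>S. d r * \<xi> (- r)) = cnj (\<Sum>r\<in>S. (if r = 0 then 1 else 0) * \<xi> r - c r * \<xi> r)"
      by (simp add: d_def bohr_dualD(4)[OF \<xi>] algebra_simps)
    also have "\<dots> = cnj (1 - trig_poly S c \<xi>)"
      using delta[of \<xi>] by (simp add: sum_subtractf trig_poly_def bohr_dualD(3)[OF \<xi>])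
    finally show "(cmod (\<Sum>r\<in>S. d r * \<xi> (- r)))\<^sup>2 = (cmod (1 - trig_poly S c \<xi>))\<^sup>2"
      by (simp only: complex_mod_cnj)
  qed
  finally have H_small: "(LINT y|m'. (cmod (H y))\<^sup>2) < e\<^sup>2"
    using \<sigma> by simp
  have "(\<Sum>r\<in>S. c r * orbit_fun \<alpha> f x (s - r)) = F (\<alpha> s x)" for x s
    using dynamical_systemD(4)[OF ds(1), of "- r" s x for r] by (simp add: F_def orbit_fun_def)
  moreover have "orbit_fun \<alpha>' g y s - (\<Sum>r\<in>S. cnj (c r) * orbit_fun \<alpha>' g y (s + r)) = H (\<alpha>' s y)" for y s
    using dynamical_systemD(4)[OF ds(2), of r s y for r]
    by (simp add: H_eq orbit_fun_def add.commute)
  ultimately show thesis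
    using birkhoff_mean_cmod_small[OF ds(1) birk(1) F e F_small]
      birkhoff_mean_cmod_small[OF ds(2) birk(2) H e H_small]
    by (intro that[OF S(1), of c]) simp_all
qed

theorem corollary9p2:
  fixes \<mu> :: "'g::{topological_ab_group_add, t2_space} measure"
    and A :: "nat \<Rightarrow> 'g set"
    and \<alpha> :: "'g \<Rightarrow> 'x::t2_space \<Rightarrow> 'x" and m :: "'x measure"
    and \<alpha>' :: "'g \<Rightarrow> 'y::t2_space \<Rightarrow> 'y" and m' :: "'y measure"
    and f :: "'x \<Rightarrow> complex" and g :: "'y \<Rightarrow> complex"
    and \<sigma>\<^sub>f \<sigma>\<^sub>g :: "('g \<Rightarrow> complex) measure"
  assumes "locally_compact_space (euclidean :: 'g topology)"
    and "sigma_compact (UNIV :: 'g set)"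
    and "separable_space (euclidean :: 'g topology)"
    and "haar_measure \<mu>"
    and "ergodic_system \<alpha> m"
    and "ergodic_system \<alpha>' m'"
    and "van_hove_sequence \<mu> A"
    and "birkhoff_holds \<mu> A \<alpha> m"
    and "birkhoff_holds \<mu> A \<alpha>' m'"
    and "continuous_on UNIV f"
    and "continuous_on UNIV g"
    and "is_spectral_measure \<alpha> m f \<sigma>\<^sub>f"
    and "is_spectral_measure \<alpha>' m' g \<sigma>\<^sub>g"
    and "mutually_singular \<sigma>\<^sub>f \<sigma>\<^sub>g"
  shows "AE (x, x') in m \<Otimes>\<^sub>M m'.
           reflected_eberlein_exists \<mu> A (orbit_fun \<alpha> f x) (orbit_fun \<alpha>' g x') \<and>
           (\<forall>t. reflected_eberlein \<mu> A (orbit_fun \<alpha> f x) (orbit_fun \<alpha>' g x') t = 0)"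
proof -
  have ds: "dynamical_system \<alpha> m" "dynamical_system \<alpha>' m'"
    using assms(5,6) by (simp_all add: ergodic_system_def)
  define small_f where "small_f e S c x \<longleftrightarrow> (\<forall>\<^sub>F n in sequentially. cmod (set_mean \<mu> (A n)
      (\<lambda>s. complex_of_real (cmod (\<Sum>r\<in>S. c r * orbit_fun \<alpha> f x (s - r))))) < e)" for e S c x
  define small_g where "small_g e S c y \<longleftrightarrow> (\<forall>\<^sub>F n in sequentially. cmod (set_mean \<mu> (A n)
      (\<lambda>s. complex_of_real (cmod (orbit_fun \<alpha>' g y s - (\<Sum>r\<in>S. cnj (c r) * orbit_fun \<alpha>' g y (s + r)))))) < e)"
    for e S c y
  have "\<exists>S c. finite S \<and> (AE x in m. small_f e S c x) \<and> (AE y in m'. small_g e S c y)"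
    if "0 < e" for e
    unfolding small_f_def small_g_def
    by (rule filtered_orbits_small[OF ds assms(8-14) that], intro exI conjI)
  \<comment> \<open>Only the countably many filters of tolerance \<open>1 / (k + 1)\<close> are used, so that the
    exceptional sets add up to a null set.\<close>
  then have "\<forall>k. \<exists>S c. finite S \<and> (AE x in m. small_f (1 / real (Suc k)) S c x) \<and>
      (AE y in m'. small_g (1 / real (Suc k)) S c y)"
    by simp
  then obtain S c where S: "\<And>k. finite (S k)"
    and ae_f: "\<And>k. AE x in m. small_f (1 / real (Suc k)) (S k) (c k) x"
    and ae_g: "\<And>k. AE y in m'. small_g (1 / real (Suc k)) (S k) (c k) y"
    by metis
  have "AE (x, y) in m \<Otimes>\<^sub>M m'. (\<forall>k. small_f (1 / real (Suc k)) (S k) (c k) x) \<and>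
      (\<forall>k. small_g (1 / real (Suc k)) (S k) (c k) y)"
    using ae_f ae_g dynamical_systemD(6)[OF ds(1)] dynamical_systemD(6)[OF ds(2)]
    by (intro AE_pair_of_AE) (simp_all add: AE_all_countable)
  then show ?thesis
  proof (rule AE_mp, intro AE_I2 impI)
    fix z :: "'x \<times> 'y"
    obtain x y where z: "z = (x, y)" by (cases z)
    assume "case z of (x, y) \<Rightarrow> (\<forall>k. small_f (1 / real (Suc k)) (S k) (c k) x) \<and>
      (\<forall>k. small_g (1 / real (Suc k)) (S k) (c k) y)"
    then have small: "small_f (1 / real (Suc k)) (S k) (c k) x" "small_g (1 / real (Suc k)) (S k) (c k) y" for k
      by (simp_all add: z)
    obtain C where C: "cmod (orbit_fun \<alpha> f x s) \<le> C" for s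
      using orbit_fun_regular(2)[OF ds(1) assms(10)] by blast
    obtain D where D: "cmod (orbit_fun \<alpha>' g y s) \<le> D" for s
      using orbit_fun_regular(2)[OF ds(2) assms(11)] by blast
    have "(\<lambda>n. set_mean \<mu> (A n) (\<lambda>s. orbit_fun \<alpha> f x s * cnj (orbit_fun \<alpha>' g y (s - t)))) \<longlonglongrightarrow> 0" for t
    proof (rule reflected_mean_tendsto_zero[OF assms(4,7) orbit_fun_regular(1)[OF ds(1) assms(10)] C
          orbit_fun_regular(1)[OF ds(2) assms(11)] D])
      fix e :: real assume "0 < e"
      then obtain k where k: "1 / real (Suc k) < e"
        using reals_Archimedean[of e] by (auto simp: inverse_eq_divide)
      have "small_f e (S k) (c k) x"
        using small(1)[of k] unfolding small_f_def by (rule eventually_mono) (rule less_trans[OF _ k])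
      moreover have "small_g e (S k) (c k) y"
        using small(2)[of k] unfolding small_g_def by (rule eventually_mono) (rule less_trans[OF _ k])
      ultimately show "\<exists>S c. finite S \<and>
        (\<forall>\<^sub>F n in sequentially. cmod (set_mean \<mu> (A n)
          (\<lambda>s. complex_of_real (cmod (\<Sum>r\<in>S. c r * orbit_fun \<alpha> f x (s - r))))) < e) \<and>
        (\<forall>\<^sub>F n in sequentially. cmod (set_mean \<mu> (A n)
          (\<lambda>s. complex_of_real (cmod (orbit_fun \<alpha>' g y s - (\<Sum>r\<in>S. cnj (c r) * orbit_fun \<alpha>' g y (s + r)))))) < e)"
        using S[of k] unfolding small_f_def small_g_def by (intro exI conjI)
    qed
    then show "case z of (x, x') \<Rightarrow>
        reflected_eberlein_exists \<mu> A (orbit_fun \<alpha> f x) (orbit_fun \<alpha>' g x') \<and>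
        (\<forall>t. reflected_eberlein \<mu> A (orbit_fun \<alpha> f x) (orbit_fun \<alpha>' g x') t = 0)"
      unfolding z reflected_eberlein_exists_def reflected_eberlein_def
      by (auto intro: convergentI limI)
  qed
qed

end
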